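(* Let $G$ be a second countable étale groupoid whose unit space $G^{(0)}$ is compact and totally disconnected, and suppose $G$ is almost finite and minimal. For clopen subsets $U,V\subset G^{(0)}$, the following are equivalent: (1) there exists $\gamma\in[G]$ with $\gamma(U)=V$; (2) $\mu(U)=\mu(V)$ for all $\mu\in M(G)$. Moreover, $\gamma$ in (1) can be chosen so that $\gamma^2=\mathrm{id}$ and $\gamma(x)=x$ for $x\in G^{(0)}\setminus(U\cup V)$.
   Context: An étale groupoid is a locally compact Hausdorff groupoid whose range map $r$ is a local homeomorphism; $s$ is the source map. The full group $[G]$ is the group of homeomorphisms $\gamma$ of $G^{(0)}$ such that for every $x\in G^{(0)}$ there is $g\in G$ with $r(g)=x$ and $s(g)=\gamma(x)$. A $G$-set is $U\subset G$ with $r|_U,s|_U$ injective. $M(G)$ is the set of probability measures $\mu$ on $G^{(0)}$ with $\mu(r(U))=\mu(s(U))$ for every open $G$-set $U$. $G$ is minimal if every orbit $r(s^{-1}(x))$ is dense. Elementary subgroupoid: compact open principal subgroupoid $K$ with $K^{(0)}=G^{(0)}$. $G$ is almost finite if for every compact $C\subset G$ and $\varepsilon>0$ there is an elementary subgroupoid $K$ with $|CKx\setminus Kx|/|K(x)|<\varepsilon$ for all $x$, where $Kx=\{k\in K:s(k)=x\}$, $CKx=\{ck:c\in C,k\in Kx,s(c)=r(k)\}$, $K(x)=r(Kx)$. *)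

theory Defs
  imports "HOL-Analysis.Analysis" "HOL-Probability.Probability"
begin

text \<open>A groupoid is given by a topology X whose underlying set topspace X is the set of
arrows, a set of units G0, range and source maps r s, a (partial) multiplication mul,
defined on composable pairs (g,h) with s g = r h, and an inverse map iv.\<close>

definition composable_pairs ::
  "'g topology \<Rightarrow> ('g \<Rightarrow> 'g) \<Rightarrow> ('g \<Rightarrow> 'g) \<Rightarrow> ('g \<times> 'g) set" where
  "composable_pairs X r s = {(g, h). g \<in> topspace X \<and> h \<in> topspace X \<and> s g = r h}"

definition groupoid ::
  "'g topology \<Rightarrow> 'g set \<Rightarrow> ('g \<Rightarrow> 'g) \<Rightarrow> ('g \<Rightarrow> 'g) \<Rightarrow> ('g \<Rightarrow> 'g \<Rightarrow> 'g) \<Rightarrow> ('g \<Rightarrow> 'g) \<Rightarrow> bool"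
  where
  "groupoid X G0 r s mul iv \<longleftrightarrow>
     G0 \<subseteq> topspace X \<and>
     (\<forall>g\<in>topspace X. r g \<in> G0 \<and> s g \<in> G0) \<and>
     (\<forall>u\<in>G0. r u = u \<and> s u = u) \<and>
     (\<forall>g\<in>topspace X. \<forall>h\<in>topspace X. s g = r h \<longrightarrow>
         mul g h \<in> topspace X \<and> r (mul g h) = r g \<and> s (mul g h) = s h) \<and>
     (\<forall>g\<in>topspace X. \<forall>h\<in>topspace X. \<forall>k\<in>topspace X. s g = r h \<longrightarrow> s h = r k \<longrightarrow>
         mul (mul g h) k = mul g (mul h k)) \<and>
     (\<forall>g\<in>topspace X. mul (r g) g = g \<and> mul g (s g) = g) \<and>
     (\<forall>g\<in>topspace X. iv g \<in> topspace X \<and> r (iv g) = s g \<and> s (iv g) = r g \<and>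
         mul g (iv g) = r g \<and> mul (iv g) g = s g)"

definition topological_groupoid ::
  "'g topology \<Rightarrow> 'g set \<Rightarrow> ('g \<Rightarrow> 'g) \<Rightarrow> ('g \<Rightarrow> 'g) \<Rightarrow> ('g \<Rightarrow> 'g \<Rightarrow> 'g) \<Rightarrow> ('g \<Rightarrow> 'g) \<Rightarrow> bool"
  where
  "topological_groupoid X G0 r s mul iv \<longleftrightarrow>
     groupoid X G0 r s mul iv \<and>
     continuous_map (subtopology (prod_topology X X) (composable_pairs X r s)) X
        (\<lambda>(g, h). mul g h) \<and>
     continuous_map X X iv"

definition local_homeomorphism :: "'a topology \<Rightarrow> 'b topology \<Rightarrow> ('a \<Rightarrow> 'b) \<Rightarrow> bool" where
  "local_homeomorphism X Y f \<longleftrightarrow>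
     continuous_map X Y f \<and>
     (\<forall>x\<in>topspace X. \<exists>U. openin X U \<and> x \<in> U \<and> openin Y (f ` U) \<and>
        homeomorphic_map (subtopology X U) (subtopology Y (f ` U)) f)"

definition etale_groupoid ::
  "'g topology \<Rightarrow> 'g set \<Rightarrow> ('g \<Rightarrow> 'g) \<Rightarrow> ('g \<Rightarrow> 'g) \<Rightarrow> ('g \<Rightarrow> 'g \<Rightarrow> 'g) \<Rightarrow> ('g \<Rightarrow> 'g) \<Rightarrow> bool"
  where
  "etale_groupoid X G0 r s mul iv \<longleftrightarrow>
     topological_groupoid X G0 r s mul iv \<and>
     locally_compact_space X \<and> Hausdorff_space X \<and>
     local_homeomorphism X (subtopology X G0) r"

definition totally_disconnected_space :: "'a topology \<Rightarrow> bool" where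
  "totally_disconnected_space T \<longleftrightarrow>
     (\<forall>S. connectedin T S \<longrightarrow> (\<forall>x\<in>S. \<forall>y\<in>S. x = y))"

definition full_group ::
  "'g topology \<Rightarrow> 'g set \<Rightarrow> ('g \<Rightarrow> 'g) \<Rightarrow> ('g \<Rightarrow> 'g) \<Rightarrow> ('g \<Rightarrow> 'g) set" where
  "full_group X G0 r s =
     {\<gamma>. homeomorphic_map (subtopology X G0) (subtopology X G0) \<gamma> \<and>
         (\<forall>x\<in>G0. \<exists>g\<in>topspace X. r g = x \<and> s g = \<gamma> x)}"

definition G_set :: "'g topology \<Rightarrow> ('g \<Rightarrow> 'g) \<Rightarrow> ('g \<Rightarrow> 'g) \<Rightarrow> 'g set \<Rightarrow> bool" where
  "G_set X r s U \<longleftrightarrow> U \<subseteq> topspace X \<and> inj_on r U \<and> inj_on s U"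

definition invariant_measures ::
  "'g topology \<Rightarrow> 'g set \<Rightarrow> ('g \<Rightarrow> 'g) \<Rightarrow> ('g \<Rightarrow> 'g) \<Rightarrow> 'g measure set" where
  "invariant_measures X G0 r s =
     {\<mu>. prob_space \<mu> \<and>
         sets \<mu> = sets (sigma G0 {V. openin (subtopology X G0) V}) \<and>
         (\<forall>U. openin X U \<longrightarrow> G_set X r s U \<longrightarrow> measure \<mu> (r ` U) = measure \<mu> (s ` U))}"

definition minimal_groupoid ::
  "'g topology \<Rightarrow> 'g set \<Rightarrow> ('g \<Rightarrow> 'g) \<Rightarrow> ('g \<Rightarrow> 'g) \<Rightarrow> bool" where
  "minimal_groupoid X G0 r s \<longleftrightarrow>
     (\<forall>x\<in>G0. (subtopology X G0) closure_of (r ` {g\<in>topspace X. s g = x}) = G0)"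

definition elementary_subgroupoid ::
  "'g topology \<Rightarrow> 'g set \<Rightarrow> ('g \<Rightarrow> 'g) \<Rightarrow> ('g \<Rightarrow> 'g) \<Rightarrow> ('g \<Rightarrow> 'g \<Rightarrow> 'g) \<Rightarrow> ('g \<Rightarrow> 'g)
   \<Rightarrow> 'g set \<Rightarrow> bool" where
  "elementary_subgroupoid X G0 r s mul iv K \<longleftrightarrow>
     K \<subseteq> topspace X \<and> compactin X K \<and> openin X K \<and> G0 \<subseteq> K \<and>
     (\<forall>g\<in>K. \<forall>h\<in>K. s g = r h \<longrightarrow> mul g h \<in> K) \<and>
     (\<forall>g\<in>K. iv g \<in> K) \<and>
     (\<forall>g\<in>K. \<forall>h\<in>K. r g = r h \<and> s g = s h \<longrightarrow> g = h)"

definition almost_finite ::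
  "'g topology \<Rightarrow> 'g set \<Rightarrow> ('g \<Rightarrow> 'g) \<Rightarrow> ('g \<Rightarrow> 'g) \<Rightarrow> ('g \<Rightarrow> 'g \<Rightarrow> 'g) \<Rightarrow> ('g \<Rightarrow> 'g) \<Rightarrow> bool"
  where
  "almost_finite X G0 r s mul iv \<longleftrightarrow>
     (\<forall>C \<epsilon>. C \<subseteq> topspace X \<and> compactin X C \<and> (\<epsilon>::real) > 0 \<longrightarrow>
        (\<exists>K. elementary_subgroupoid X G0 r s mul iv K \<and>
          (\<forall>x\<in>G0.
             let Kx = {k\<in>K. s k = x};
                 CKx = {mul c k | c k. c \<in> C \<and> k \<in> Kx \<and> s c = r k}
             in real (card (CKx - Kx)) / real (card (r ` Kx)) < \<epsilon>)))"

end

theory Submission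
  imports Defs "HOL-Library.Diagonal_Subsequence"
begin

text \<open>A full group element is, on countably many Borel pieces, given by compact open bisections,
  so it preserves invariant measures.

  Conversely, orbits of a sequence of elementary subgroupoids witnessing almost finiteness carry
  uniform measures whose weak limits are invariant. Hence if \<open>\<mu> A < \<mu> B\<close> for all invariant \<open>\<mu>\<close>, then
  some such elementary subgroupoid \<open>K\<close> satisfies \<open>|K(x) \<inter> A| \<le> |K(x) \<inter> B|\<close> for all \<open>x\<close>, and a greedy
  matching inside \<open>K\<close> gives a bisection from \<open>A\<close> into \<open>B\<close>.

  If \<open>\<mu> U = \<mu> V\<close> for all \<open>\<mu>\<close>, with \<open>U\<close> and \<open>V\<close> disjoint and nonempty, minimality provides an arrow from
  some \<open>x\<^sub>0 \<in> U\<close> to some \<open>y\<^sub>0 \<in> V\<close>. Since small neighbourhoods of \<open>y\<^sub>0\<close> have uniformly smaller measure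
  than a given neighbourhood of \<open>x\<^sub>0\<close>, and vice versa, a back-and-forth argument produces growing
  bisections between \<open>U - {x\<^sub>0}\<close> and \<open>V - {y\<^sub>0}\<close> that exhaust the complements of all neighbourhoods of
  \<open>x\<^sub>0\<close> and \<open>y\<^sub>0\<close>. Exchanging \<open>x\<^sub>0\<close> and \<open>y\<^sub>0\<close> as well yields a continuous involution.\<close>

subsection \<open>Compact open bisections\<close>

text \<open>The total disconnectedness of the units makes compact open bisections a base of the
  topology of arrows (\<open>bisection_nbhd\<close>). Almost finiteness and minimality stay explicit
  hypotheses of the lemmas that use them.\<close>

locale ample_groupoid =
  fixes X :: "'g topology" and G0 :: "'g set" and r s :: "'g \<Rightarrow> 'g"
    and mul :: "'g \<Rightarrow> 'g \<Rightarrow> 'g" and iv :: "'g \<Rightarrow> 'g"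
  assumes etale: "etale_groupoid X G0 r s mul iv"
    and second_countable: "second_countable X"
    and compact_units: "compact_space (subtopology X G0)"
    and totally_disconnected: "totally_disconnected_space (subtopology X G0)"
begin

section \<open>Groupoid axioms and continuity of the structure maps\<close>

lemma groupoid: "groupoid X G0 r s mul iv"
  using etale unfolding etale_groupoid_def topological_groupoid_def by blast

lemma Hausdorff: "Hausdorff_space X"
  using etale unfolding etale_groupoid_def by blast

lemma units_subset: "G0 \<subseteq> topspace X"
  using groupoid unfolding groupoid_def by blast

lemma r_unit [simp]: "u \<in> G0 \<Longrightarrow> r u = u" and s_unit [simp]: "u \<in> G0 \<Longrightarrow> s u = u"
  using groupoid unfolding groupoid_def by blast+

lemma r_in_units [simp]: "g \<in> topspace X \<Longrightarrow> r g \<in> G0"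
  and s_in_units [simp]: "g \<in> topspace X \<Longrightarrow> s g \<in> G0"
  using groupoid unfolding groupoid_def by blast+

lemma r_mul: "\<lbrakk>g \<in> topspace X; h \<in> topspace X; s g = r h\<rbrakk> \<Longrightarrow> r (mul g h) = r g"
  and s_mul: "\<lbrakk>g \<in> topspace X; h \<in> topspace X; s g = r h\<rbrakk> \<Longrightarrow> s (mul g h) = s h"
  using groupoid unfolding groupoid_def by blast+

lemma mul_assoc:
  "\<lbrakk>g \<in> topspace X; h \<in> topspace X; k \<in> topspace X; s g = r h; s h = r k\<rbrakk>
    \<Longrightarrow> mul (mul g h) k = mul g (mul h k)"
  using groupoid unfolding groupoid_def by blast

lemma mul_r: "g \<in> topspace X \<Longrightarrow> mul (r g) g = g" and mul_s: "g \<in> topspace X \<Longrightarrow> mul g (s g) = g"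
  using groupoid unfolding groupoid_def by blast+

lemma iv_closed [simp]: "g \<in> topspace X \<Longrightarrow> iv g \<in> topspace X"
  and r_iv [simp]: "g \<in> topspace X \<Longrightarrow> r (iv g) = s g"
  and s_iv [simp]: "g \<in> topspace X \<Longrightarrow> s (iv g) = r g"
  and iv_mul: "g \<in> topspace X \<Longrightarrow> mul (iv g) g = s g"
  using groupoid unfolding groupoid_def by blast+

lemma iv_iv [simp]:
  assumes g: "g \<in> topspace X"
  shows "iv (iv g) = g"
proof -
  have "iv (iv g) = mul (iv (iv g)) (mul (iv g) g)"
    using mul_s[of "iv (iv g)"] iv_mul[OF g] g by simp
  also have "\<dots> = mul (mul (iv (iv g)) (iv g)) g"
    using mul_assoc[of "iv (iv g)" "iv g" g] g by simp
  also have "\<dots> = g"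
    using iv_mul[of "iv g"] mul_r[OF g] g by simp
  finally show ?thesis .
qed

lemma continuous_r: "continuous_map X X r"
  using etale continuous_map_in_subtopology
  unfolding etale_groupoid_def local_homeomorphism_def by blast

lemma continuous_iv: "continuous_map X X iv"
  using etale unfolding etale_groupoid_def topological_groupoid_def by blast

lemma continuous_s: "continuous_map X X s"
proof -
  have "continuous_map X X (r \<circ> iv)"
    using continuous_iv continuous_r continuous_map_compose by blast
  then show ?thesis
    by (rule continuous_map_eq) auto
qed

section \<open>Openness of the units, the range map and the source map\<close>

lemma local_injective_r:
  assumes "g \<in> topspace X"
  obtains N where "openin X N" "g \<in> N" "inj_on r N"
    "homeomorphic_map (subtopology X N) (subtopology X (r ` N)) r"
    "openin (subtopology X G0) (r ` N)"
proof -
  obtain N where N: "openin X N" "g \<in> N" "openin (subtopology X G0) (r ` N)"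
    "homeomorphic_map (subtopology X N) (subtopology (subtopology X G0) (r ` N)) r"
    using etale assms unfolding etale_groupoid_def local_homeomorphism_def by blast
  have "r ` N \<subseteq> G0" using N(1) openin_subset by fastforce
  then have "subtopology (subtopology X G0) (r ` N) = subtopology X (r ` N)"
    by (simp add: subtopology_subtopology Int_absorb1)
  moreover have "inj_on r N"
    using homeomorphic_imp_injective_map[OF N(4)] openin_subset[OF N(1)]
    by (simp add: topspace_subtopology Int_absorb1)
  ultimately show ?thesis using that N by metis
qed

text \<open>Let \<open>r\<close> be injective on a neighbourhood \<open>N\<close> of a unit. If both
  \<open>g\<close> and \<open>r g\<close> lie in \<open>N\<close>, then \<open>r (r g) = r g\<close>
  forces \<open>g = r g\<close>, so \<open>g\<close> is a unit; by continuity of \<open>r\<close>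
  this holds for all \<open>g\<close> close to the given unit.\<close>

lemma openin_units: "openin X G0"
proof (subst openin_subopen, intro ballI)
  fix u assume u: "u \<in> G0"
  obtain N where N: "openin X N" "u \<in> N" "inj_on r N"
    using local_injective_r u units_subset by blast
  define M where "M = N \<inter> {g \<in> topspace X. r g \<in> N}"
  have "openin X M"
    unfolding M_def by (intro openin_Int N openin_continuous_map_preimage[OF continuous_r])
  moreover have "u \<in> M"
    using N u units_subset by (auto simp: M_def)
  moreover have "M \<subseteq> G0"
  proof
    fix g assume "g \<in> M"
    then have g: "g \<in> N" "r g \<in> N" "g \<in> topspace X" by (auto simp: M_def)
    have "r (r g) = r g" using g by simp
    then have "r g = g" using N(3) g by (simp add: inj_on_def)
    then show "g \<in> G0" using g by (metis r_in_units)
  qed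
  ultimately show "\<exists>T. openin X T \<and> u \<in> T \<and> T \<subseteq> G0" by blast
qed

lemma openin_units_iff: "openin (subtopology X G0) A \<longleftrightarrow> openin X A \<and> A \<subseteq> G0"
  using openin_open_subtopology[OF openin_units] by blast

lemma openin_r_image:
  assumes W: "openin X W"
  shows "openin X (r ` W)"
proof (subst openin_subopen, intro ballI)
  fix y assume "y \<in> r ` W"
  then obtain g where g: "g \<in> W" "y = r g" by blast
  obtain N where N: "openin X N" "g \<in> N" "inj_on r N"
    "homeomorphic_map (subtopology X N) (subtopology X (r ` N)) r"
    "openin (subtopology X G0) (r ` N)"
    using local_injective_r g openin_subset[OF W] by blast
  have "openin (subtopology X N) (N \<inter> W)"
    using W by (simp add: openin_subtopology_Int2)
  then have "openin (subtopology X (r ` N)) (r ` (N \<inter> W))"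
    using homeomorphic_map_openness_eq[OF N(4)] by blast
  moreover have "openin X (r ` N)" using N(5) openin_units_iff by blast
  ultimately have "openin X (r ` (N \<inter> W))"
    using openin_trans_full by blast
  then show "\<exists>T. openin X T \<and> y \<in> T \<and> T \<subseteq> r ` W"
    using g N(2) by blast
qed

lemma iv_image_eq: 
  assumes "W \<subseteq> topspace X"
  shows "iv ` W = {g \<in> topspace X. iv g \<in> W}"
proof (intro equalityI subsetI)
  fix g assume "g \<in> {g \<in> topspace X. iv g \<in> W}"
  then have "iv g \<in> W" "g = iv (iv g)" by auto
  then show "g \<in> iv ` W" by blast
qed (use assms in auto)

lemma openin_iv_image: "openin X W \<Longrightarrow> openin X (iv ` W)"
  using iv_image_eq[of W] openin_subset[of X W]
    openin_continuous_map_preimage[OF continuous_iv] by simp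

lemma r_iv_image: "W \<subseteq> topspace X \<Longrightarrow> r ` iv ` W = s ` W"
  and s_iv_image: "W \<subseteq> topspace X \<Longrightarrow> s ` iv ` W = r ` W"
  by (force simp: image_image)+

lemma openin_s_image: "openin X W \<Longrightarrow> openin X (s ` W)"
  using openin_r_image openin_iv_image r_iv_image openin_subset by metis

section \<open>The Boolean calculus of compact open sets and the base of bisections\<close>

text \<open>Compactness is taken in \<open>X\<close> so that one notion serves arrows and units
  alike; for subsets of \<open>G0\<close> it amounts to being clopen there
  (\<open>clopen_iff\<close>).\<close>

definition compact_open :: "'g set \<Rightarrow> bool" where
  "compact_open W \<longleftrightarrow> openin X W \<and> compactin X W"

text \<open>Unlike for a general open \<open>G_set\<close>, compactness is built in, so that there
  are only countably many bisections.\<close>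

definition bisection :: "'g set \<Rightarrow> bool" where
  "bisection W \<longleftrightarrow> compact_open W \<and> inj_on r W \<and> inj_on s W"

lemma compact_open_openin: "compact_open W \<Longrightarrow> openin X W"
  and compact_open_compactin: "compact_open W \<Longrightarrow> compactin X W"
  and compact_open_subset: "compact_open W \<Longrightarrow> W \<subseteq> topspace X"
  and compact_open_closedin: "compact_open W \<Longrightarrow> closedin X W"
  using compactin_imp_closedin[OF Hausdorff] openin_subset
  by (auto simp: compact_open_def)

lemma compact_open_empty [simp]: "compact_open {}"
  by (simp add: compact_open_def)

lemma compact_open_Un: "\<lbrakk>compact_open A; compact_open B\<rbrakk> \<Longrightarrow> compact_open (A \<union> B)"
  by (simp add: compact_open_def compactin_Un openin_Un)

lemma compact_open_Diff:
  assumes A: "compact_open A" and B: "compact_open B"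
  shows "compact_open (A - B)"
proof -
  have "closedin X (topspace X - B)" using compact_open_openin[OF B] by blast
  then have "compactin X ((topspace X - B) \<inter> A)"
    using closed_Int_compactin compact_open_compactin[OF A] by blast
  moreover have "(topspace X - B) \<inter> A = A - B" using compact_open_subset[OF A] by blast
  ultimately show ?thesis
    using openin_diff[OF compact_open_openin[OF A] compact_open_closedin[OF B]]
    by (simp add: compact_open_def)
qed

lemma compact_open_Int: "\<lbrakk>compact_open A; compact_open B\<rbrakk> \<Longrightarrow> compact_open (A \<inter> B)"
  using compact_open_Diff[of A "A - B"] compact_open_Diff[of A B] by (simp add: Diff_Diff_Int)

lemma compact_open_UN: "\<lbrakk>finite I; \<And>i. i \<in> I \<Longrightarrow> compact_open (A i)\<rbrakk> \<Longrightarrow> compact_open (\<Union>i\<in>I. A i)"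
  by (induction I rule: finite_induct) (auto intro: compact_open_Un)

lemma compact_open_units: "compact_open G0"
  using compact_units openin_units units_subset
  by (simp add: compact_open_def compact_space_subtopology compactin_subspace)

lemma compact_open_r_image: "compact_open W \<Longrightarrow> compact_open (r ` W)"
  using openin_r_image image_compactin[OF _ continuous_r] by (simp add: compact_open_def)

lemma compact_open_s_image: "compact_open W \<Longrightarrow> compact_open (s ` W)"
  using openin_s_image image_compactin[OF _ continuous_s] by (simp add: compact_open_def)

lemma compact_open_iv_image: "compact_open W \<Longrightarrow> compact_open (iv ` W)"
  using openin_iv_image image_compactin[OF _ continuous_iv] by (simp add: compact_open_def)

lemma compact_open_preimage:
  assumes W: "compact_open W" and A: "compact_open A" and f: "continuous_map X X f"
  shows "compact_open {w \<in> W. f w \<in> A}"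
proof -
  have eq: "{w \<in> W. f w \<in> A} = {w \<in> topspace X. f w \<in> A} \<inter> W"
    using compact_open_subset[OF W] by auto
  have "closedin X {w \<in> topspace X. f w \<in> A}"
    using closedin_continuous_map_preimage[OF f] compact_open_closedin[OF A] by blast
  then have "compactin X {w \<in> W. f w \<in> A}"
    unfolding eq using closed_Int_compactin compact_open_compactin[OF W] by blast
  moreover have "openin X {w \<in> W. f w \<in> A}"
    unfolding eq using openin_continuous_map_preimage[OF f] compact_open_openin W A by blast
  ultimately show ?thesis by (simp add: compact_open_def)
qed

lemma clopen_iff:
  "closedin (subtopology X G0) A \<and> openin (subtopology X G0) A \<longleftrightarrow> compact_open A \<and> A \<subseteq> G0"
proof
  assume A: "closedin (subtopology X G0) A \<and> openin (subtopology X G0) A"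
  then have "A \<subseteq> G0" "openin X A" using openin_units_iff by auto
  moreover have "compactin (subtopology X G0) A"
    using A compact_units closedin_compact_space by blast
  ultimately show "compact_open A \<and> A \<subseteq> G0"
    by (simp add: compact_open_def compactin_subtopology)
next
  assume A: "compact_open A \<and> A \<subseteq> G0"
  then show "closedin (subtopology X G0) A \<and> openin (subtopology X G0) A"
    using openin_units_iff compact_open_closedin closedin_subset_topspace compact_open_openin by metis
qed

text \<open>In a compact Hausdorff space two closed sets that no connected set joins are separated
  by a clopen set. Here every connected set has at most one point, so \<open>x\<close> can be split
  off from the complement of \<open>N\<close>.\<close>

lemma clopen_nbhd:
  assumes N: "openin X N" "N \<subseteq> G0" and x: "x \<in> N"
  obtains A where "compact_open A" "x \<in> A" "A \<subseteq> N"
proof -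
  let ?Y = "subtopology X G0"
  have top: "topspace ?Y = G0" using units_subset by auto
  have H: "Hausdorff_space ?Y" using Hausdorff Hausdorff_space_subtopology by blast
  have "closedin ?Y {x}"
    using closedin_Hausdorff_singleton[OF H] N x top by blast
  moreover have "closedin ?Y (G0 - N)"
    using N top openin_units_iff closedin_diff[OF closedin_topspace, of ?Y N] by simp
  moreover have "disjnt C {x} \<or> disjnt C (G0 - N)" if "connectedin ?Y C" for C
  proof (rule ccontr)
    assume "\<not> (disjnt C {x} \<or> disjnt C (G0 - N))"
    then obtain y where "x \<in> C" "y \<in> C" "y \<notin> N" by (auto simp: disjnt_def)
    then show False
      using that totally_disconnected x unfolding totally_disconnected_space_def by metis
  qed
  ultimately have "separated_between ?Y {x} (G0 - N)"
    using cut_wire_fence_theorem[OF compact_units H] by blast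
  then obtain A where A: "closedin ?Y A" "openin ?Y A" "x \<in> A" "G0 - N \<subseteq> G0 - A"
    unfolding separated_between top by blast
  then have "compact_open A" "A \<subseteq> G0" using clopen_iff by auto
  then show ?thesis using that A by blast
qed

lemma bisection_compact_open: "bisection W \<Longrightarrow> compact_open W"
  and bisection_inj_r: "bisection W \<Longrightarrow> inj_on r W"
  and bisection_inj_s: "bisection W \<Longrightarrow> inj_on s W"
  and bisection_subset: "bisection W \<Longrightarrow> W \<subseteq> topspace X"
  using compact_open_subset by (auto simp: bisection_def)

lemma bisection_empty [simp]: "bisection {}"
  by (simp add: bisection_def)

lemma bisection_iv_image: 
  assumes W: "bisection W"
  shows "bisection (iv ` W)"
proof -
  have "W \<subseteq> topspace X" using W by (rule bisection_subset)
  then have "inj_on r (iv ` W)" "inj_on s (iv ` W)"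
    using W by (auto simp: bisection_def inj_on_def subset_iff)
  then show ?thesis using W compact_open_iv_image by (simp add: bisection_def)
qed

text \<open>Injectivity of \<open>s\<close> near \<open>g\<close> is injectivity of \<open>r\<close>
  near \<open>iv g\<close>, carried over by inversion. Compactness comes from a clopen neighbourhood
  of \<open>r g\<close>, pulled back along the local homeomorphism \<open>r\<close>.\<close>

lemma bisection_nbhd:
  assumes O: "openin X O'" and g: "g \<in> O'"
  obtains W where "bisection W" "g \<in> W" "W \<subseteq> O'"
proof -
  have gX: "g \<in> topspace X" using O g openin_subset by blast
  obtain N where N: "openin X N" "g \<in> N" "inj_on r N"
    "homeomorphic_map (subtopology X N) (subtopology X (r ` N)) r"
    using local_injective_r[OF gX] by blast
  obtain M where M: "openin X M" "iv g \<in> M" "inj_on r M"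
    using local_injective_r gX iv_closed by blast
  define L where "L = O' \<inter> N \<inter> iv ` M"
  have L: "openin X L" unfolding L_def using O N(1) openin_iv_image[OF M(1)] by blast
  have "g \<in> iv ` M" using M(2) gX by (metis iv_iv image_eqI)
  then have gL: "g \<in> L" using g N by (auto simp: L_def)
  have MX: "M \<subseteq> topspace X" using M(1) openin_subset by blast
  have "inj_on s (iv ` M)"
    using M(3) MX by (auto simp: inj_on_def subset_iff)
  then have injL: "inj_on s L" "inj_on r L"
    using N(3) by (auto simp: L_def intro: inj_on_subset)
  have LX: "L \<subseteq> topspace X" using L openin_subset by blast
  have "r ` L \<subseteq> G0" using LX by auto
  then obtain A where A: "compact_open A" "r g \<in> A" "A \<subseteq> r ` L"
    using clopen_nbhd[OF openin_r_image[OF L], of "r g"] gL by blast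
  define W where "W = {w \<in> L. r w \<in> A}"
  have WN: "W \<subseteq> N" by (auto simp: W_def L_def)
  have "W = L \<inter> {w \<in> topspace X. r w \<in> A}" using LX by (auto simp: W_def)
  then have oW: "openin X W"
    using openin_continuous_map_preimage[OF continuous_r] L A(1) compact_open_openin by auto
  have rW: "r ` W = A" using A by (auto simp: W_def)
  have "compactin (subtopology X (r ` N)) A"
    using A compact_open_compactin rW WN by (auto simp: compactin_subtopology)
  then have "compactin (subtopology X N) W"
    using homeomorphic_map_compactness_eq[OF N(4)] rW WN N(1) openin_subset 
    by (metis (no_types, lifting) homeomorphic_map_compactness topspace_subtopology_subset)
  then have "compactin X W" by (simp add: compactin_subtopology)
  then have "bisection W"
    using oW injL by (auto simp: bisection_def compact_open_def W_def inj_on_def)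
  moreover have "g \<in> W" using gL A by (auto simp: W_def)
  moreover have "W \<subseteq> O'" by (auto simp: W_def L_def)
  ultimately show ?thesis using that by blast
qed

lemma compact_open_finite_bisections:
  assumes "compact_open K"
  obtains F where "finite F" "\<And>W. W \<in> F \<Longrightarrow> bisection W" "K = \<Union>F"
proof -
  let ?\<W> = "{W. bisection W \<and> W \<subseteq> K}"
  have "K \<subseteq> \<Union>?\<W>"
    using bisection_nbhd[OF compact_open_openin[OF assms]] by blast
  moreover have "\<And>W. W \<in> ?\<W> \<Longrightarrow> openin X W"
    using bisection_compact_open compact_open_openin by blast
  ultimately obtain F where "finite F" "F \<subseteq> ?\<W>" "K \<subseteq> \<Union>F"
    using compactinD[OF compact_open_compactin[OF assms]] by meson
  then show ?thesis using that[of F] by blast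
qed

text \<open>By compactness such a set is a finite union of members of a countable base, and a
  countable base has only countably many finite subfamilies.\<close>

lemma countable_compact_open: "countable {W. compact_open W}"
proof -
  obtain \<B> where B: "countable \<B>" "\<And>V. V \<in> \<B> \<Longrightarrow> openin X V"
      "\<And>U x. openin X U \<Longrightarrow> x \<in> U \<Longrightarrow> \<exists>V\<in>\<B>. x \<in> V \<and> V \<subseteq> U"
    using second_countable unfolding second_countable_def by metis
  have "W \<in> Union ` {F. finite F \<and> F \<subseteq> \<B>}" if W: "compact_open W" for W
  proof -
    have "W \<subseteq> \<Union>{V\<in>\<B>. V \<subseteq> W}" using B(3) compact_open_openin[OF W] by blast
    then obtain F where "finite F" "F \<subseteq> {V\<in>\<B>. V \<subseteq> W}" "W \<subseteq> \<Union>F"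
      using compactinD[OF compact_open_compactin[OF W], of "{V\<in>\<B>. V \<subseteq> W}"] B(2) by auto
    then have "finite F \<and> F \<subseteq> \<B>" "W = \<Union>F" by auto
    then show ?thesis by blast
  qed
  then have "{W. compact_open W} \<subseteq> Union ` {F. finite F \<and> F \<subseteq> \<B>}" by blast
  moreover have "countable {F. finite F \<and> F \<subseteq> \<B>}"
    using countable_Collect_finite_subset[OF B(1)] by simp
  ultimately show ?thesis by (meson countable_image countable_subset)
qed

lemma openin_Union_bisections: "openin X O' \<Longrightarrow> O' = \<Union>{W. bisection W \<and> W \<subseteq> O'}"
  using bisection_nbhd by blast

text \<open>A compact open set is covered by finitely many bisections, and each of them meets a
  source fibre at most once.\<close>

lemma finite_source_fibre:
  assumes "compact_open K"
  shows "finite {k \<in> K. s k = x}"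
proof -
  obtain F where F: "finite F" "\<And>W. W \<in> F \<Longrightarrow> bisection W" "K = \<Union>F"
    using compact_open_finite_bisections[OF assms] by blast
  have "finite {k \<in> W. s k = x}" if "W \<in> F" for W
  proof (cases "\<exists>k\<in>W. s k = x")
    case True
    then obtain k where "k \<in> W" "s k = x" by blast
    then have "{k \<in> W. s k = x} \<subseteq> {k}"
      using bisection_inj_s[OF F(2)[OF that]] by (auto simp: inj_on_def)
    then show ?thesis using finite_subset by blast
  next
    case False
    then have "{k \<in> W. s k = x} = {}" by blast
    then show ?thesis by (metis finite.emptyI)
  qed
  moreover have "{k \<in> K. s k = x} = (\<Union>W\<in>F. {k \<in> W. s k = x})" using F by blast
  ultimately show ?thesis using F(1) by simp
qed

subsection \<open>Invariant measures and the full group\<close>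

lemma invariant_measure_prob_space: "\<mu> \<in> invariant_measures X G0 r s \<Longrightarrow> prob_space \<mu>"
  and sets_invariant_measure:
    "\<mu> \<in> invariant_measures X G0 r s \<Longrightarrow> sets \<mu> = sigma_sets G0 {V. openin (subtopology X G0) V}"
  and space_invariant_measure: "\<mu> \<in> invariant_measures X G0 r s \<Longrightarrow> space \<mu> = G0"
proof -
  have "{V. openin (subtopology X G0) V} \<subseteq> Pow G0" using openin_units_iff by blast
  then have sp: "sets (sigma G0 {V. openin (subtopology X G0) V}) = sigma_sets G0 {V. openin (subtopology X G0) V}"
    "space (sigma G0 {V. openin (subtopology X G0) V}) = G0"
    by (simp_all add: space_measure_of_conv)
  show "\<mu> \<in> invariant_measures X G0 r s \<Longrightarrow> prob_space \<mu>"
    "\<mu> \<in> invariant_measures X G0 r s \<Longrightarrow> sets \<mu> = sigma_sets G0 {V. openin (subtopology X G0) V}"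
    "\<mu> \<in> invariant_measures X G0 r s \<Longrightarrow> space \<mu> = G0"
    using sp sets_eq_imp_space_eq[of \<mu> "sigma G0 {V. openin (subtopology X G0) V}"]
    by (auto simp: invariant_measures_def)
qed

lemma open_in_sets:
  "\<lbrakk>\<mu> \<in> invariant_measures X G0 r s; openin X A; A \<subseteq> G0\<rbrakk> \<Longrightarrow> A \<in> sets \<mu>"
  by (simp add: sets_invariant_measure openin_units_iff sigma_sets.Basic)

lemma clopen_in_sets:
  "\<lbrakk>\<mu> \<in> invariant_measures X G0 r s; compact_open A; A \<subseteq> G0\<rbrakk> \<Longrightarrow> A \<in> sets \<mu>"
  using open_in_sets compact_open_openin by blast

lemma r_image_units: "W \<subseteq> topspace X \<Longrightarrow> r ` W \<subseteq> G0"
  and s_image_units: "W \<subseteq> topspace X \<Longrightarrow> s ` W \<subseteq> G0"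
  by auto

lemma measure_bisection:
  "\<lbrakk>\<mu> \<in> invariant_measures X G0 r s; bisection W\<rbrakk> \<Longrightarrow> measure \<mu> (r ` W) = measure \<mu> (s ` W)"
  using compact_open_openin[of W] compact_open_subset[of W]
  by (simp add: invariant_measures_def G_set_def bisection_def)

text \<open>For open \<open>B\<close> the restricted bisection is again an open G-set, so invariance
  applies. Open sets are stable under intersection and generate the \<sigma>-algebra; injectivity of
  \<open>s\<close> lets the claim pass to complements and disjoint unions.\<close>

lemma measure_bisection_borel:
  assumes \<mu>: "\<mu> \<in> invariant_measures X G0 r s" and W: "bisection W" and B: "B \<in> sets \<mu>"
  shows "s ` {w \<in> W. r w \<in> B} \<in> sets \<mu> \<and>
         measure \<mu> (s ` {w \<in> W. r w \<in> B}) = measure \<mu> (B \<inter> r ` W)"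
proof -
  interpret prob_space \<mu> using \<mu> by (rule invariant_measure_prob_space)
  let ?E = "{V. openin (subtopology X G0) V}"
  have WX: "W \<subseteq> topspace X" using W by (rule bisection_subset)
  have oW: "openin X W" using W bisection_compact_open compact_open_openin by blast
  have rs: "r ` W \<in> sets \<mu>" "s ` W \<in> sets \<mu>"
    using open_in_sets[OF \<mu>] openin_r_image[OF oW] openin_s_image[OF oW]
      r_image_units[OF WX] s_image_units[OF WX] by blast+
  have injs: "inj_on s W" using W by (rule bisection_inj_s)
  have "Int_stable ?E" by (auto simp: Int_stable_def openin_Int)
  moreover have "?E \<subseteq> Pow G0" using openin_units_iff by blast
  moreover have "B \<in> sigma_sets G0 ?E" using B sets_invariant_measure[OF \<mu>] by simp
  ultimately show ?thesis
  proof (induction B rule: sigma_sets_induct_disjoint)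
    case (basic A)
    then have A: "openin X A" "A \<subseteq> G0" using openin_units_iff by auto
    define V where "V = {w \<in> W. r w \<in> A}"
    have "V = W \<inter> {w \<in> topspace X. r w \<in> A}" using WX by (auto simp: V_def)
    then have V: "openin X V"
      using openin_continuous_map_preimage[OF continuous_r A(1)] oW by auto
    moreover have VW: "V \<subseteq> W" by (auto simp: V_def)
    ultimately have "G_set X r s V"
      using W WX by (auto simp: G_set_def bisection_def intro: inj_on_subset)
    then have "measure \<mu> (r ` V) = measure \<mu> (s ` V)"
      using \<mu> V by (simp add: invariant_measures_def)
    moreover have "r ` V = A \<inter> r ` W" by (auto simp: V_def)
    moreover have "s ` V \<in> sets \<mu>"
      using open_in_sets[OF \<mu> openin_s_image[OF V]] s_image_units[of V] VW WX by blast
    ultimately show ?case by (simp add: V_def)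
  next
    case empty
    then show ?case by simp
  next
    case (compl A)
    then have A: "A \<in> sets \<mu>" using sets_invariant_measure[OF \<mu>] by simp
    have "{w \<in> W. r w \<in> G0 - A} = W - {w \<in> W. r w \<in> A}" using WX by auto
    then have 1: "s ` {w \<in> W. r w \<in> G0 - A} = s ` W - s ` {w \<in> W. r w \<in> A}"
      using inj_on_image_set_diff[OF injs, of W "{w \<in> W. r w \<in> A}"] by auto
    have 2: "(G0 - A) \<inter> r ` W = r ` W - A \<inter> r ` W" using WX by auto
    show ?case
      unfolding 1 2 using compl.IH rs A measure_bisection[OF \<mu> W]
      by (subst (1 2) finite_measure_Diff) auto
  next
    case (union A)
    then have A: "A i \<in> sets \<mu>" for i using sets_invariant_measure[OF \<mu>] by auto
    have 1: "s ` {w \<in> W. r w \<in> \<Union>(range A)} = (\<Union>i. s ` {w \<in> W. r w \<in> A i})" by auto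
    have 2: "\<Union>(range A) \<inter> r ` W = (\<Union>i. A i \<inter> r ` W)" by auto
    have "disjoint_family (\<lambda>i. s ` {w \<in> W. r w \<in> A i})"
      unfolding disjoint_family_on_def
    proof (intro ballI impI)
      fix i j :: nat assume "i \<noteq> j"
      then have "A i \<inter> A j = {}" using union.hyps(1) by (simp add: disjoint_family_on_def)
      then show "s ` {w \<in> W. r w \<in> A i} \<inter> s ` {w \<in> W. r w \<in> A j} = {}"
        using injs by (auto simp: inj_on_def)
    qed
    then have "(\<lambda>i. measure \<mu> (s ` {w \<in> W. r w \<in> A i})) sums measure \<mu> (\<Union>i. s ` {w \<in> W. r w \<in> A i})"
      using union.IH by (intro finite_measure_UNION) auto
    moreover have "(\<lambda>i. measure \<mu> (A i \<inter> r ` W)) sums measure \<mu> (\<Union>i. A i \<inter> r ` W)"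
      using union.hyps(1) A rs by (intro finite_measure_UNION) (auto simp: disjoint_family_on_def)
    ultimately show ?case
      unfolding 1 2 using union.IH sums_unique2 by auto
  qed
qed

lemma bisection_enumeration:
  obtains B :: "nat \<Rightarrow> 'g set" where "range B = {W. bisection W}"
proof -
  have "countable {W. bisection W}"
    using countable_compact_open by (rule countable_subset[rotated]) (auto simp: bisection_def)
  then show ?thesis
    using that range_from_nat_into[of "{W. bisection W}"] bisection_empty by blast
qed

text \<open>A full group element agrees with a single bisection on closed, but usually not open, pieces,
  so invariance has to be used for Borel subsets of bisections.\<close>

lemma full_group_measure_preserving:
  assumes \<mu>: "\<mu> \<in> invariant_measures X G0 r s" and \<gamma>: "\<gamma> \<in> full_group X G0 r s"
    and U: "U \<in> sets \<mu>"
  shows "measure \<mu> (\<gamma> ` U) = measure \<mu> U"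
proof -
  interpret prob_space \<mu> using \<mu> by (rule invariant_measure_prob_space)
  have UG: "U \<subseteq> G0" using U sets.sets_into_space space_invariant_measure[OF \<mu>] by blast
  have top: "topspace (subtopology X G0) = G0" using units_subset by auto
  have hom: "homeomorphic_map (subtopology X G0) (subtopology X G0) \<gamma>"
    and orb: "\<And>x. x \<in> G0 \<Longrightarrow> \<exists>g\<in>topspace X. r g = x \<and> s g = \<gamma> x"
    using \<gamma> by (auto simp: full_group_def)
  have inj: "inj_on \<gamma> G0" using homeomorphic_imp_injective_map[OF hom] top by simp
  have "continuous_map X (subtopology X G0) r"
    using continuous_r by (auto simp: continuous_map_in_subtopology)
  then have "continuous_map X (subtopology X G0) (\<gamma> \<circ> r)"
    using continuous_map_compose homeomorphic_imp_continuous_map[OF hom] by blast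
  then have cont: "continuous_map X X (\<gamma> \<circ> r)"
    by (simp add: continuous_map_in_subtopology)
  obtain B :: "nat \<Rightarrow> 'g set" where B: "range B = {W. bisection W}"
    using bisection_enumeration by blast
  then have bis: "bisection (B n)" for n by auto
  \<comment> \<open>These are the arrows of \<open>B n\<close> that realise \<open>\<gamma>\<close>.
    As the equaliser of two continuous maps into a Hausdorff space, \<open>D n\<close> is closed in
    \<open>B n\<close>, hence compact, and so its range image is Borel.\<close>
  define D where "D n = {w \<in> B n. \<gamma> (r w) = s w}" for n
  have D_sets: "r ` D n \<in> sets \<mu>" for n
  proof -
    have "D n = {w \<in> topspace X. (\<gamma> \<circ> r) w = s w} \<inter> B n"
      using bisection_subset[OF bis] by (auto simp: D_def)
    moreover have "closedin X {w \<in> topspace X. (\<gamma> \<circ> r) w = s w}"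
      using closedin_continuous_maps_eq[OF Hausdorff cont continuous_s] .
    ultimately have "compactin X (D n)"
      using closed_Int_compactin compact_open_compactin[OF bisection_compact_open[OF bis]] by metis
    then have "closedin X (r ` D n)"
      using image_compactin[OF _ continuous_r] compactin_imp_closedin[OF Hausdorff] by blast
    moreover have "r ` D n \<subseteq> G0" using bisection_subset[OF bis[of n]] by (auto simp: D_def)
    ultimately have "openin X (G0 - r ` D n)" "r ` D n = G0 - (G0 - r ` D n)"
      using openin_units by blast+
    then show ?thesis
      using open_in_sets[OF \<mu>, of "G0 - r ` D n"] sets.compl_sets[of "G0 - r ` D n" \<mu>]
        space_invariant_measure[OF \<mu>] by auto
  qed
  \<comment> \<open>The images under \<open>r\<close> of the \<open>D n\<close> cover the units,
    since each \<open>x\<close> has an arrow to \<open>\<gamma> x\<close> and this arrow lies in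
    some bisection. Making them disjoint allows the measures of the pieces to be summed.\<close>
  define E where "E = disjointed (\<lambda>n. r ` D n)"
  have E_sets: "E n \<in> sets \<mu>" for n
    using sets.range_disjointed_sets[of "\<lambda>n. r ` D n" \<mu>] D_sets by (auto simp: E_def)
  have E_disj: "disjoint_family E" by (simp add: E_def disjoint_family_disjointed)
  have ED: "E n \<subseteq> r ` D n" for n by (auto simp: E_def disjointed_def)
  have "G0 \<subseteq> (\<Union>n. r ` D n)"
  proof
    fix x assume x: "x \<in> G0"
    then obtain g where g: "g \<in> topspace X" "r g = x" "s g = \<gamma> x" using orb by blast
    obtain W where "bisection W" "g \<in> W" using bisection_nbhd[OF openin_topspace g(1)] by blast
    moreover then obtain n where "W = B n" using B by blast
    ultimately have "g \<in> D n" using g by (auto simp: D_def)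
    then show "x \<in> (\<Union>n. r ` D n)" using g by blast
  qed
  then have E_cover: "U = (\<Union>n. U \<inter> E n)"
    using UG UN_disjointed_eq[of "\<lambda>n. r ` D n"] by (auto simp: E_def)
  \<comment> \<open>On \<open>E n\<close> the map \<open>\<gamma>\<close> is the partial map given
    by \<open>B n\<close>: an arrow of \<open>B n\<close> is determined by its range, so it
    coincides with the one in \<open>D n\<close>.\<close>
  have piece: "\<gamma> ` (U \<inter> E n) = s ` {w \<in> B n. r w \<in> U \<inter> E n}" for n
  proof -
    have "\<gamma> (r w) = s w" if w: "w \<in> B n" "r w \<in> E n" for w
    proof -
      obtain d where d: "d \<in> D n" "r d = r w" using w ED by fastforce
      then have "d = w" using bisection_inj_r[OF bis[of n]] w by (auto simp: inj_on_def D_def)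
      then show ?thesis using d by (simp add: D_def)
    qed
    moreover have "U \<inter> E n = r ` {w \<in> B n. r w \<in> U \<inter> E n}"
      using ED[of n] by (auto simp: D_def)
    ultimately show ?thesis by (force simp: image_iff)
  qed
  have UE: "U \<inter> E n \<in> sets \<mu>" for n using U E_sets by auto
  have eq: "\<gamma> ` (U \<inter> E n) \<in> sets \<mu> \<and> measure \<mu> (\<gamma> ` (U \<inter> E n)) = measure \<mu> (U \<inter> E n)" for n
  proof -
    have "U \<inter> E n \<inter> r ` B n = U \<inter> E n" using ED[of n] by (auto simp: D_def)
    then show ?thesis
      using measure_bisection_borel[OF \<mu> bis UE, of n n] unfolding piece by simp
  qed
  have "disjoint_family (\<lambda>n. \<gamma> ` (U \<inter> E n))"
    unfolding disjoint_family_on_def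
  proof (intro ballI impI)
    fix m n :: nat assume "m \<noteq> n"
    then have "E m \<inter> E n = {}" using E_disj by (simp add: disjoint_family_on_def)
    then show "\<gamma> ` (U \<inter> E m) \<inter> \<gamma> ` (U \<inter> E n) = {}"
      using inj UG by (auto simp: inj_on_def)
  qed
  then have "(\<lambda>n. measure \<mu> (\<gamma> ` (U \<inter> E n))) sums measure \<mu> (\<Union>n. \<gamma> ` (U \<inter> E n))"
    using eq by (intro finite_measure_UNION) auto
  moreover have "(\<lambda>n. measure \<mu> (U \<inter> E n)) sums measure \<mu> (\<Union>n. U \<inter> E n)"
    using UE E_disj by (intro finite_measure_UNION) (auto simp: disjoint_family_on_def)
  moreover have "(\<Union>n. \<gamma> ` (U \<inter> E n)) = \<gamma> ` U" using E_cover by blast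
  ultimately show ?thesis using eq sums_unique2 E_cover by auto
qed

subsection \<open>Comparison of clopen sets\<close>

text \<open>The bisections in \<open>F\<close> are processed one after the other, each contributing
  all its arrows between points that are still free. Free points only become fewer, so an arrow
  blocked at its own stage remains blocked.\<close>

lemma greedy_matching:
  assumes "finite F" "\<And>W. W \<in> F \<Longrightarrow> bisection W" and A: "compact_open A" and B: "compact_open B"
  shows "\<exists>T. bisection T \<and> T \<subseteq> \<Union>F \<and> s ` T \<subseteq> A \<and> r ` T \<subseteq> B \<and>
             (\<forall>k\<in>\<Union>F. s k \<in> A - s ` T \<longrightarrow> r k \<notin> B - r ` T)"
  using assms(1,2)
proof (induction F rule: finite_induct)
  case empty
  show ?case by (rule exI[of _ "{}"]) auto
next
  case (insert W F)
  then obtain T where T: "bisection T" "T \<subseteq> \<Union>F" "s ` T \<subseteq> A" "r ` T \<subseteq> B"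
    "\<forall>k\<in>\<Union>F. s k \<in> A - s ` T \<longrightarrow> r k \<notin> B - r ` T" by (meson insertI2)
  have W: "bisection W" using insert by simp
  have cT: "compact_open T" using T(1) by (rule bisection_compact_open)
  \<comment> \<open>Injectivity on \<open>T'\<close> is inherited from \<open>W\<close>; the
    restriction to free sources and free ranges keeps the union with \<open>T\<close>
    injective.\<close>
  define T' where "T' = {w \<in> {w \<in> W. s w \<in> A - s ` T}. r w \<in> B - r ` T}"
  have cT': "compact_open T'"
    unfolding T'_def using W cT A B
    by (intro compact_open_preimage continuous_r continuous_s compact_open_Diff
        compact_open_s_image compact_open_r_image) (simp_all add: bisection_compact_open)
  have "inj_on r T'" "inj_on s T'"
    using W by (auto simp: T'_def bisection_def inj_on_def)
  moreover have T'_sub: "r ` T' \<subseteq> B - r ` T" "s ` T' \<subseteq> A - s ` T"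
    by (auto simp: T'_def)
  ultimately have "inj_on r (T \<union> T')" "inj_on s (T \<union> T')"
    using bisection_inj_r[OF T(1)] bisection_inj_s[OF T(1)] unfolding inj_on_Un by blast+
  then have "bisection (T \<union> T')"
    using cT cT' compact_open_Un by (simp add: bisection_def)
  moreover have "T \<union> T' \<subseteq> \<Union>(insert W F)" "s ` (T \<union> T') \<subseteq> A" "r ` (T \<union> T') \<subseteq> B"
    using T T'_sub by (auto simp: T'_def)
  moreover have "r k \<notin> B - r ` (T \<union> T')"
    if "k \<in> \<Union>(insert W F)" "s k \<in> A - s ` (T \<union> T')" for k
    using that T(5) unfolding T'_def by blast
  ultimately show ?case by blast
qed

lemma elementary_compact_open: "elementary_subgroupoid X G0 r s mul iv K \<Longrightarrow> compact_open K"
  by (simp add: elementary_subgroupoid_def compact_open_def)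

abbreviation orbit :: "'g set \<Rightarrow> 'g \<Rightarrow> 'g set" where
  "orbit K x \<equiv> r ` {k \<in> K. s k = x}"

lemma finite_orbit: "elementary_subgroupoid X G0 r s mul iv K \<Longrightarrow> finite (orbit K x)"
  using finite_source_fibre elementary_compact_open by blast

text \<open>A greedy matching fails to exhaust an orbit of \<open>A\<close> only if it exhausts that orbit of \<open>B\<close>.\<close>

lemma matching_from_orbit_counts:
  assumes K: "elementary_subgroupoid X G0 r s mul iv K"
    and A: "compact_open A" "A \<subseteq> G0" and B: "compact_open B"
    and le: "\<And>x. x \<in> G0 \<Longrightarrow> card (orbit K x \<inter> A) \<le> card (orbit K x \<inter> B)"
  shows "\<exists>T. bisection T \<and> s ` T = A \<and> r ` T \<subseteq> B"
proof -
  obtain F where F: "finite F" "\<And>W. W \<in> F \<Longrightarrow> bisection W" "K = \<Union>F"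
    using compact_open_finite_bisections[OF elementary_compact_open[OF K]] by blast
  obtain T where T: "bisection T" "T \<subseteq> K" "s ` T \<subseteq> A" "r ` T \<subseteq> B"
    "\<forall>k\<in>K. s k \<in> A - s ` T \<longrightarrow> r k \<notin> B - r ` T"
    using greedy_matching[OF F(1,2) A(1) B] unfolding F(3)[symmetric] by blast
  have KX: "K \<subseteq> topspace X" and GK: "G0 \<subseteq> K"
    and mulK: "\<And>g h. g \<in> K \<Longrightarrow> h \<in> K \<Longrightarrow> s g = r h \<Longrightarrow> mul g h \<in> K"
    and ivK: "\<And>g. g \<in> K \<Longrightarrow> iv g \<in> K"
    using K by (auto simp: elementary_subgroupoid_def)
  have "a \<in> s ` T" if a: "a \<in> A" for a
  proof (rule ccontr)
    assume nT: "a \<notin> s ` T"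
    let ?O = "orbit K a"
    have fin: "finite ?O" using finite_orbit[OF K] .
    have aG: "a \<in> G0" using a A by blast
    then have aO: "a \<in> ?O" using GK by (force simp: image_iff)
    \<comment> \<open>By maximality of \<open>T\<close> an unmatched \<open>a\<close> leaves no free
      point of \<open>B\<close> in its orbit.\<close>
    have sub: "?O \<inter> B \<subseteq> r ` T"
      using T(5) a nT by auto
    have injr: "inj_on r T" and injs: "inj_on s T" using T(1) by (auto simp: bisection_def)
    \<comment> \<open>A point of \<open>B\<close> is sent to the source of the arrow of
      \<open>T\<close> that ends there.\<close>
    define f where "f = s \<circ> the_inv_into T r"
    have "inj_on f (?O \<inter> B)"
      unfolding f_def
    proof (rule comp_inj_on)
      show "inj_on (the_inv_into T r) (?O \<inter> B)"
        using inj_on_the_inv_into[OF injr] sub inj_on_subset by blast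
      show "inj_on s (the_inv_into T r ` (?O \<inter> B))"
        using injs sub the_inv_into_into[OF injr] by (auto simp: inj_on_def subset_iff)
    qed
    \<comment> \<open>The product of \<open>iv t\<close> and \<open>k\<close> lies in
      \<open>K\<close>, so the partner of a point of the orbit is in the orbit too. It differs from
      \<open>a\<close>, which is unmatched, and this makes the count strictly too small.\<close>
    moreover have "f ` (?O \<inter> B) \<subseteq> (?O \<inter> A) - {a}"
    proof
      fix z assume "z \<in> f ` (?O \<inter> B)"
      then obtain y where y: "y \<in> ?O" "y \<in> B" "z = f y" by blast
      then obtain t where t: "t \<in> T" "r t = y" using sub by auto
      then have "z = s t" using y the_inv_into_f_f[OF injr t(1)] by (simp add: f_def)
      obtain k where k: "k \<in> K" "s k = a" "r k = y" using y by blast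
      have tk: "t \<in> topspace X" "t \<in> K" "k \<in> topspace X" using t k T(2) KX by auto
      have "mul (iv t) k \<in> K" using mulK ivK tk k t by auto
      moreover have "r (mul (iv t) k) = s t" "s (mul (iv t) k) = a"
        using tk k t r_mul[of "iv t" k] s_mul[of "iv t" k] by auto
      ultimately have "s t \<in> ?O" by force
      then show "z \<in> (?O \<inter> A) - {a}" using \<open>z = s t\<close> t(1) T(3) nT by blast
    qed
    ultimately have "card (?O \<inter> B) \<le> card ((?O \<inter> A) - {a})"
      using card_inj_on_le fin by blast
    also have "\<dots> < card (?O \<inter> A)"
      using fin aO a by (intro psubset_card_mono) auto
    finally show False using le[OF aG] by simp
  qed
  then have "s ` T = A" using T(3) by blast
  then show ?thesis using T by blast
qed

section \<open>Invariant measures as weak limits of orbit counts\<close>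

text \<open>A diagonal subsequence makes the densities of all countably many clopen sets converge.
  The limit is finitely additive, and compactness upgrades this to a measure on the generated
  \<sigma>-algebra.\<close>

lemma limit_measure:
  assumes fin: "\<And>n. finite (Q n)" and ne: "\<And>n. Q n \<noteq> {}" and sub: "\<And>n. Q n \<subseteq> G0"
  obtains \<rho> :: "nat \<Rightarrow> nat" and \<mu> where "strict_mono \<rho>" "prob_space \<mu>"
    "sets \<mu> = sets (sigma G0 {V. openin (subtopology X G0) V})"
    "\<And>A. \<lbrakk>compact_open A; A \<subseteq> G0\<rbrakk> \<Longrightarrow>
       (\<lambda>n. real (card (Q (\<rho> n) \<inter> A)) / real (card (Q (\<rho> n)))) \<longlonglongrightarrow> measure \<mu> A"
proof -
  define M where "M = {A. compact_open A \<and> A \<subseteq> G0}"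
  define d where "d n A = real (card (Q n \<inter> A)) / real (card (Q n))" for n A
  have pos: "card (Q n) > 0" for n using fin ne by (simp add: card_gt_0_iff)
  have d_nonneg: "0 \<le> d n A" for n A by (simp add: d_def)
  have d_le: "d n A \<le> 1" for n A
    using card_mono[OF fin, of "Q n \<inter> A" n] pos[of n] by (simp add: d_def divide_le_eq_1)
  have d_G0: "d n G0 = 1" for n using sub[of n] pos[of n] by (simp add: d_def Int_absorb2)
  have d_add: "d n (A \<union> B) = d n A + d n B" if "A \<inter> B = {}" for n A B
  proof -
    have "card (Q n \<inter> (A \<union> B)) = card (Q n \<inter> A) + card (Q n \<inter> B)"
      using that fin by (subst card_Un_disjoint[symmetric]) (auto simp: Int_Un_distrib)
    then show ?thesis by (simp add: d_def add_divide_distrib)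
  qed
  have M0: "{} \<in> M" by (simp add: M_def)
  have cM: "countable M"
    using countable_compact_open by (rule countable_subset[rotated]) (auto simp: M_def)
  obtain c :: "nat \<Rightarrow> 'g set" where c: "range c = M"
    using range_from_nat_into[OF _ cM] M0 by blast
  \<comment> \<open>For each clopen set the densities lie between 0 and 1, so every subsequence has
    a further one along which they converge.\<close>
  interpret subseqs "\<lambda>k \<rho>. convergent (\<lambda>n. d (\<rho> n) (c k))"
  proof
    fix k and \<sigma> :: "nat \<Rightarrow> nat" assume "strict_mono \<sigma>"
    have "bounded (range (\<lambda>n. d (\<sigma> n) (c k)))"
      using d_nonneg d_le by (intro boundedI[of _ 1]) (auto simp: abs_of_nonneg)
    then obtain l \<tau> where "strict_mono \<tau>" "((\<lambda>n. d (\<sigma> n) (c k)) \<circ> \<tau>) \<longlonglongrightarrow> l"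
      using bounded_imp_convergent_subsequence by blast
    then show "\<exists>\<tau>. strict_mono \<tau> \<and> convergent (\<lambda>n. d ((\<sigma> \<circ> \<tau>) n) (c k))"
      unfolding convergent_def comp_def by blast
  qed
  have conv: "convergent (\<lambda>n. d (diagseq n) A)" if A: "A \<in> M" for A
  proof -
    obtain k where k: "A = c k" using A c by blast
    \<comment> \<open>The diagonal sequence is known to obey the requirement for \<open>c k\<close>
      only after its first \<open>Suc k\<close> terms; dropping these does not affect
      convergence.\<close>
    have "convergent (\<lambda>n. d ((diagseq \<circ> ((+) (Suc k))) n) (c k))"
    proof (rule diagseq_holds)
      fix \<tau> \<sigma> :: "nat \<Rightarrow> nat" and n
      assume "strict_mono \<tau>" "convergent (\<lambda>m. d (\<sigma> m) (c n))"
      then show "convergent (\<lambda>m. d ((\<sigma> \<circ> \<tau>) m) (c n))"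
        using convergent_subseq_convergent[of "\<lambda>m. d (\<sigma> m) (c n)" \<tau>] by (simp add: comp_def)
    qed
    then have "convergent (\<lambda>n. d (diagseq (n + Suc k)) (c k))"
      by (simp add: comp_def add.commute)
    then show ?thesis
      using convergent_ignore_initial_segment[of "\<lambda>n. d (diagseq n) (c k)" "Suc k"] k by simp
  qed
  define L where "L A = lim (\<lambda>n. d (diagseq n) A)" for A
  have L: "(\<lambda>n. d (diagseq n) A) \<longlonglongrightarrow> L A" if "A \<in> M" for A
    using conv[OF that] by (simp add: L_def convergent_LIMSEQ_iff)
  have L_nonneg: "0 \<le> L A" if "A \<in> M" for A
    using LIMSEQ_le_const[OF L[OF that]] d_nonneg by blast
  have L_add: "L (A \<union> B) = L A + L B" if "A \<in> M" "B \<in> M" "A \<union> B \<in> M" "A \<inter> B = {}" for A B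
    using LIMSEQ_unique[OF L[OF that(3)]] tendsto_add[OF L[OF that(1)] L[OF that(2)]]
      d_add[OF that(4)] by auto
  have L_empty: "L {} = 0"
    using LIMSEQ_unique[OF L[OF M0], of 0] by (simp add: d_def)
  have G0M: "G0 \<in> M" using compact_open_units by (simp add: M_def)
  have L_G0: "L G0 = 1"
    using LIMSEQ_unique[OF L[OF G0M], of 1] by (simp add: d_G0)
  have "algebra G0 M"
    unfolding algebra_iff_Un using compact_open_Un compact_open_Diff[OF compact_open_units]
    by (auto simp: M_def)
  then interpret algebra G0 M .
  \<comment> \<open>For Caratheodory's extension it suffices to have continuity at the empty set. A
    decreasing sequence of clopen sets with empty intersection is eventually empty, as the units are
    compact.\<close>
  have "\<exists>m. (\<forall>A\<in>M. m A = ennreal (L A)) \<and> measure_space G0 (sigma_sets G0 M) m"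
  proof (rule caratheodory_empty_continuous)
    show "positive M (\<lambda>A. ennreal (L A))" by (simp add: positive_def L_empty)
    show "additive M (\<lambda>A. ennreal (L A))"
      unfolding additive_def using L_add[OF _ _ Un] L_nonneg by (simp add: ennreal_plus)
    fix A :: "nat \<Rightarrow> 'g set"
    assume A: "range A \<subseteq> M" "decseq A" "(\<Inter>i. A i) = {}"
    have "\<exists>n. A n = {}"
    proof (rule ccontr)
      assume "\<not> (\<exists>n. A n = {})"
      moreover have "closedin (subtopology X G0) (A n)" for n
        using A(1) clopen_iff[of "A n"] by (auto simp: M_def)
      ultimately show False
        using compact_space_imp_nest[OF compact_units, of A] A by blast
    qed
    then obtain n where n: "A n = {}" by blast
    have "A i = {}" if "i \<ge> n" for i using decseqD[OF A(2) that] n by blast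
    then have "eventually (\<lambda>i. ennreal (L (A i)) = 0) sequentially"
      unfolding eventually_sequentially using L_empty by (intro exI[of _ n]) simp
    then show "(\<lambda>i. ennreal (L (A i))) \<longlonglongrightarrow> 0" by (rule tendsto_eventually)
  qed auto
  then obtain m where m: "\<And>A. A \<in> M \<Longrightarrow> m A = ennreal (L A)"
    "measure_space G0 (sigma_sets G0 M) m" by blast
  define \<mu> where "\<mu> = measure_of G0 (sigma_sets G0 M) m"
  have ms: "sigma_algebra G0 (sigma_sets G0 M)" "positive (sigma_sets G0 M) m"
    "countably_additive (sigma_sets G0 M) m"
    using m(2) by (auto simp: measure_space_def)
  have MP: "M \<subseteq> Pow G0" by (auto simp: M_def)
  have sets_\<mu>: "sets \<mu> = sigma_sets G0 M"
    unfolding \<mu>_def using ms(1) by (simp add: sigma_algebra.sets_measure_of_eq)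
  have em: "emeasure \<mu> A = ennreal (L A)" if "A \<in> M" for A
    using emeasure_measure_of_sigma[OF ms sigma_sets.Basic[OF that]] m(1)[OF that]
    by (simp add: \<mu>_def)
  have "space \<mu> = G0" unfolding \<mu>_def by (simp add: space_measure_of_conv)
  then have "prob_space \<mu>"
    using em[OF G0M] L_G0 by (intro prob_spaceI) simp
  moreover have "sets \<mu> = sets (sigma G0 {V. openin (subtopology X G0) V})"
  proof -
    have "{V. openin (subtopology X G0) V} \<subseteq> Pow G0" using openin_units_iff by blast
    then have "sets (sigma G0 {V. openin (subtopology X G0) V})
        = sigma_sets G0 {V. openin (subtopology X G0) V}" by simp
    also have "\<dots> = sigma_sets G0 M"
    proof (rule sigma_sets_eqI)
      fix V assume "V \<in> {V. openin (subtopology X G0) V}"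
      then have V: "openin X V" "V \<subseteq> G0" using openin_units_iff by auto
      \<comment> \<open>Since there are only countably many clopen sets, this union is countable;
        hence clopen sets generate the Borel sets.\<close>
      have "V = \<Union>{A \<in> M. A \<subseteq> V}"
      proof (intro equalityI subsetI)
        fix x assume "x \<in> V"
        then obtain A where "compact_open A" "x \<in> A" "A \<subseteq> V" using clopen_nbhd[OF V] by blast
        then show "x \<in> \<Union>{A \<in> M. A \<subseteq> V}" using V(2) unfolding M_def by blast
      qed blast
      moreover have "\<Union>{A \<in> M. A \<subseteq> V} \<in> sigma_sets G0 M"
        using cM by (intro sigma_sets_UNION) (auto intro: countable_subset)
      ultimately show "V \<in> sigma_sets G0 M" by simp
    next
      fix A assume "A \<in> M"
      then show "A \<in> sigma_sets G0 {V. openin (subtopology X G0) V}"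
        using openin_units_iff compact_open_openin by (intro sigma_sets.Basic) (auto simp: M_def)
    qed
    finally show ?thesis using sets_\<mu> by simp
  qed
  moreover have "(\<lambda>n. real (card (Q (diagseq n) \<inter> A)) / real (card (Q (diagseq n)))) \<longlonglongrightarrow> measure \<mu> A"
    if "compact_open A" "A \<subseteq> G0" for A
  proof -
    have A: "A \<in> M" using that by (simp add: M_def)
    then have "measure \<mu> A = L A" using em L_nonneg by (simp add: measure_def)
    then show ?thesis using L[OF A] by (simp add: d_def)
  qed
  ultimately show ?thesis using that[OF subseq_diagseq] by blast
qed

text \<open>Move each \<open>y\<close> in the orbit along the arrow of \<open>W\<close> that starts
  there. If it stays in the orbit, it is counted by the first term. Otherwise the arrow composed
  with one of \<open>K\<close> from \<open>x\<close> to \<open>y\<close> lies in \<open>CKx\<close>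
  but not in \<open>Kx\<close>. Both assignments are injective, because they determine the range of
  the arrow of \<open>W\<close>.\<close>

lemma orbit_almost_invariant:
  assumes K: "elementary_subgroupoid X G0 r s mul iv K" and C: "compact_open C"
    and W: "bisection W" "W \<subseteq> C"
  shows "card (orbit K x \<inter> s ` W) \<le> card (orbit K x \<inter> r ` W) +
     card ({mul c k | c k. c \<in> C \<and> k \<in> {k\<in>K. s k = x} \<and> s c = r k} - {k\<in>K. s k = x})"
proof -
  let ?Kx = "{k\<in>K. s k = x}" and ?O = "orbit K x"
  let ?CK = "{mul c k | c k. c \<in> C \<and> k \<in> ?Kx \<and> s c = r k}"
  have finK: "finite ?Kx" using finite_source_fibre elementary_compact_open[OF K] by blast
  \<comment> \<open>Finiteness has to be secured first, as \<open>card\<close> is 0 on infinite sets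
    and would give no bound.\<close>
  have "?CK \<subseteq> (\<lambda>(k, c). mul c k) ` (SIGMA k:?Kx. {c\<in>C. s c = r k})" by force
  moreover have "finite (SIGMA k:?Kx. {c\<in>C. s c = r k})"
    using finK finite_source_fibre[OF C] by (intro finite_SigmaI) auto
  ultimately have finCK: "finite ?CK" by (rule finite_subset[OF _ finite_imageI])
  have injs: "inj_on s W" and injr: "inj_on r W" using W(1) by (auto simp: bisection_def)
  have WX: "W \<subseteq> topspace X" using W(1) by (rule bisection_subset)
  have KX: "K \<subseteq> topspace X" using K by (simp add: elementary_subgroupoid_def)
  define w where "w = the_inv_into W s"
  have w: "w y \<in> W" "s (w y) = y" if "y \<in> s ` W" for y
    using that the_inv_into_into[OF injs] f_the_inv_into_f[OF injs] by (auto simp: w_def)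
  define k where "k y = (SOME k. k \<in> ?Kx \<and> r k = y)" for y
  have k: "k y \<in> ?Kx \<and> r (k y) = y" if "y \<in> ?O" for y
    unfolding k_def by (rule someI_ex) (use that in blast)
  define Y where "Y = ?O \<inter> s ` W"
  define Y1 where "Y1 = {y \<in> Y. r (w y) \<in> ?O}"
  define Y2 where "Y2 = {y \<in> Y. r (w y) \<notin> ?O}"
  have finY: "finite Y" using finite_orbit[OF K] by (simp add: Y_def)
  have inj: "inj_on (\<lambda>y. r (w y)) Y"
  proof (rule inj_onI)
    fix y z assume "y \<in> Y" "z \<in> Y" "r (w y) = r (w z)"
    moreover then have "y \<in> s ` W" "z \<in> s ` W" by (auto simp: Y_def)
    ultimately show "y = z" using w injr by (metis inj_onD)
  qed
  have "card Y1 \<le> card (?O \<inter> r ` W)"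
  proof (rule card_inj_on_le)
    show "inj_on (\<lambda>y. r (w y)) Y1" using inj by (rule inj_on_subset) (auto simp: Y1_def)
    show "(\<lambda>y. r (w y)) ` Y1 \<subseteq> ?O \<inter> r ` W" using w by (auto simp: Y1_def Y_def)
  qed (use finite_orbit[OF K] in blast)
  moreover have "card Y2 \<le> card (?CK - ?Kx)"
  proof (rule card_inj_on_le)
    have prod: "w y \<in> topspace X" "k y \<in> topspace X" "s (w y) = r (k y)" if "y \<in> Y2" for y
      using that w[of y] k[of y] WX KX by (auto simp: Y2_def Y_def)
    have rm: "r (mul (w y) (k y)) = r (w y)" if "y \<in> Y2" for y
      using r_mul prod[OF that] by blast
    show "inj_on (\<lambda>y. mul (w y) (k y)) Y2"
    proof (rule inj_onI)
      fix y z assume yz: "y \<in> Y2" "z \<in> Y2" "mul (w y) (k y) = mul (w z) (k z)"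
      then have "r (w y) = r (w z)" using rm by metis
      then show "y = z" using inj yz by (auto simp: Y2_def inj_on_def)
    qed
    show "(\<lambda>y. mul (w y) (k y)) ` Y2 \<subseteq> ?CK - ?Kx"
    proof (rule image_subsetI)
      fix y assume y: "y \<in> Y2"
      then have "w y \<in> C" "k y \<in> ?Kx" using w[of y] k[of y] W(2) by (auto simp: Y2_def Y_def)
      then have "mul (w y) (k y) \<in> ?CK" using prod[OF y] by blast
      \<comment> \<open>Membership in \<open>Kx\<close> would put \<open>r (w y)\<close>, the range
        of the product, into the orbit.\<close>
      moreover have "mul (w y) (k y) \<notin> ?Kx"
      proof
        assume "mul (w y) (k y) \<in> ?Kx"
        then have "r (mul (w y) (k y)) \<in> ?O" by (rule imageI)
        then show False using rm[OF y] y by (simp add: Y2_def)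
      qed
      ultimately show "mul (w y) (k y) \<in> ?CK - ?Kx" by blast
    qed
  qed (use finCK in blast)
  moreover have "card Y = card Y1 + card Y2"
  proof -
    have "Y = Y1 \<union> Y2" "Y1 \<inter> Y2 = {}" by (auto simp: Y1_def Y2_def)
    then show ?thesis using finY card_Un_disjoint[of Y1 Y2] by auto
  qed
  ultimately show ?thesis by (simp add: Y_def)
qed

text \<open>Almost finiteness is applied to growing finite unions of an enumeration of all
  bisections, with tolerance \<open>1 / real (Suc n)\<close>. Every bisection is contained in all
  sufficiently late unions, so a single sequence serves all of them.\<close>

lemma almost_finite_sequence:
  assumes af: "almost_finite X G0 r s mul iv"
  obtains K where "\<And>n. elementary_subgroupoid X G0 r s mul iv (K n)"
    "\<And>W. bisection W \<Longrightarrow> \<exists>N. \<forall>n\<ge>N. \<forall>x\<in>G0.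
       real (card (orbit (K n) x \<inter> s ` W)) / real (card (orbit (K n) x))
       \<le> real (card (orbit (K n) x \<inter> r ` W)) / real (card (orbit (K n) x)) + 1 / real (Suc n)"
proof -
  obtain B :: "nat \<Rightarrow> 'g set" where B: "range B = {W. bisection W}"
    using bisection_enumeration by blast
  define C where "C n = (\<Union>i\<le>n. B i)" for n
  have C: "compact_open (C n)" for n
    unfolding C_def using B by (intro compact_open_UN) (auto simp: bisection_def)
  let ?P = "\<lambda>n K x. real (card ({mul c k | c k. c \<in> C n \<and> k \<in> {k\<in>K. s k = x} \<and> s c = r k} - {k\<in>K. s k = x}))
      / real (card (orbit K x)) < 1 / real (Suc n)"
  have "\<exists>K. elementary_subgroupoid X G0 r s mul iv K \<and> (\<forall>x\<in>G0. ?P n K x)" for n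
    using af[unfolded almost_finite_def Let_def, rule_format, of "C n" "1 / real (Suc n)"]
      compact_open_subset[OF C[of n]] compact_open_compactin[OF C[of n]] by simp
  then have "\<forall>n. \<exists>K. elementary_subgroupoid X G0 r s mul iv K \<and> (\<forall>x\<in>G0. ?P n K x)" by (rule allI)
  then obtain K where "\<forall>n. elementary_subgroupoid X G0 r s mul iv (K n) \<and> (\<forall>x\<in>G0. ?P n (K n) x)"
    by (rule choice[THEN exE])
  then have K: "\<And>n. elementary_subgroupoid X G0 r s mul iv (K n)"
    "\<And>n x. x \<in> G0 \<Longrightarrow> ?P n (K n) x" by (simp_all only:)
  have "\<exists>N. \<forall>n\<ge>N. \<forall>x\<in>G0.
       real (card (orbit (K n) x \<inter> s ` W)) / real (card (orbit (K n) x))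
       \<le> real (card (orbit (K n) x \<inter> r ` W)) / real (card (orbit (K n) x)) + 1 / real (Suc n)"
    if W: "bisection W" for W
  proof -
    obtain N where N: "W = B N" using B W by blast
    have "real (card (orbit (K n) x \<inter> s ` W)) / real (card (orbit (K n) x))
       \<le> real (card (orbit (K n) x \<inter> r ` W)) / real (card (orbit (K n) x)) + 1 / real (Suc n)"
      if n: "n \<ge> N" and x: "x \<in> G0" for n x
    proof -
      have "W \<subseteq> C n" using N n by (auto simp: C_def)
      note * = orbit_almost_invariant[OF K(1)[of n] C[of n] W this, of x]
      let ?a = "real (card (orbit (K n) x \<inter> s ` W))" and ?b = "real (card (orbit (K n) x \<inter> r ` W))"
        and ?c = "real (card ({mul c k | c k. c \<in> C n \<and> k \<in> {k\<in>K n. s k = x} \<and> s c = r k} - {k\<in>K n. s k = x}))"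
        and ?d = "real (card (orbit (K n) x))"
      have "?a \<le> ?b + ?c" using * by linarith
      then have "?a / ?d \<le> (?b + ?c) / ?d" by (intro divide_right_mono) auto
      also have "\<dots> = ?b / ?d + ?c / ?d" by (rule add_divide_distrib)
      also have "\<dots> \<le> ?b / ?d + 1 / real (Suc n)" using K(2)[OF x, of n] by linarith
      finally show ?thesis .
    qed
    then show ?thesis by blast
  qed
  then show ?thesis using that K(1) by blast
qed

text \<open>An open G-set is a countable disjoint union of bisections. Injectivity of
  \<open>r\<close> and \<open>s\<close> keeps the images disjoint, so invariance on bisections
  passes to it by countable additivity.\<close>

lemma invariant_measureI:
  assumes p: "prob_space \<mu>" and sets: "sets \<mu> = sets (sigma G0 {V. openin (subtopology X G0) V})"
    and inv: "\<And>W. bisection W \<Longrightarrow> measure \<mu> (r ` W) = measure \<mu> (s ` W)"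
  shows "\<mu> \<in> invariant_measures X G0 r s"
proof -
  interpret prob_space \<mu> by (rule p)
  have "measure \<mu> (r ` V) = measure \<mu> (s ` V)" if V: "openin X V" "G_set X r s V" for V
  proof -
    have VX: "V \<subseteq> topspace X" and injr: "inj_on r V" and injs: "inj_on s V"
      using V(2) by (auto simp: G_set_def)
    obtain B :: "nat \<Rightarrow> 'g set" where B: "range B = {W. bisection W}"
      using bisection_enumeration by blast
    \<comment> \<open>Bisections not inside \<open>V\<close> are replaced by the empty set, so the
      sequence runs only through subsets of \<open>V\<close>.\<close>
    define B' where "B' i = (if B i \<subseteq> V then B i else {})" for i
    define D where "D = disjointed B'"
    have B': "compact_open (B' i)" "B' i \<subseteq> V" for i
      using B by (auto simp: B'_def bisection_def)
    have "V = \<Union>{W. bisection W \<and> W \<subseteq> V}" using openin_Union_bisections[OF V(1)] .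
    also have "\<dots> = (\<Union>i. B' i)"
    proof (intro equalityI subsetI)
      fix g assume "g \<in> \<Union>{W. bisection W \<and> W \<subseteq> V}"
      then obtain W where W: "bisection W" "W \<subseteq> V" "g \<in> W" by blast
      then obtain i where "W = B i" using B by blast
      then have "g \<in> B' i" using W by (simp add: B'_def)
      then show "g \<in> (\<Union>i. B' i)" by blast
    next
      fix g assume "g \<in> (\<Union>i. B' i)"
      then obtain i where i: "g \<in> B' i" by blast
      then have "B' i = B i" "B i \<subseteq> V" by (auto simp: B'_def split: if_splits)
      moreover have "bisection (B i)" using B by blast
      ultimately show "g \<in> \<Union>{W. bisection W \<and> W \<subseteq> V}" using i by blast
    qed
    finally have VD: "V = (\<Union>i. D i)" using UN_disjointed_eq[of B'] by (simp add: D_def)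
    have D_disj: "disjoint_family D" by (simp add: D_def disjoint_family_disjointed)
    have DV: "D i \<subseteq> V" for i using VD by blast
    have "compact_open (D i)" for i
      unfolding D_def disjointed_def using B' by (intro compact_open_Diff compact_open_UN) auto
    then have bis: "bisection (D i)" for i
      using injr injs DV[of i] by (auto simp: bisection_def intro: inj_on_subset)
    have sums: "(\<lambda>i. measure \<mu> (f ` D i)) sums measure \<mu> (f ` V)"
      if f: "inj_on f V" "\<And>i. openin X (f ` D i)" "\<And>i. f ` D i \<subseteq> G0" for f
    proof -
      have 1: "f ` V = (\<Union>i. f ` D i)" using VD by blast
      have "disjoint_family (\<lambda>i. f ` D i)"
        unfolding disjoint_family_on_def
      proof (intro ballI impI)
        fix i j :: nat assume "i \<noteq> j"
        then have "D i \<inter> D j = {}" using D_disj by (simp add: disjoint_family_on_def)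
        then show "f ` D i \<inter> f ` D j = {}"
          using inj_on_image_Int[OF f(1) DV DV, of i j] by simp
      qed
      moreover have "f ` D i \<in> sets \<mu>" for i
        unfolding sets using f(2,3) openin_units_iff
        by (subst sets_measure_of) (auto intro: sigma_sets.Basic)
      ultimately show ?thesis unfolding 1 by (intro finite_measure_UNION) auto
    qed
    have "(\<lambda>i. measure \<mu> (r ` D i)) sums measure \<mu> (r ` V)"
      using injr openin_r_image compact_open_openin bisection_compact_open bis
        r_image_units[OF bisection_subset] by (intro sums) auto
    moreover have "(\<lambda>i. measure \<mu> (s ` D i)) sums measure \<mu> (s ` V)"
      using injs openin_s_image compact_open_openin bisection_compact_open bis
        s_image_units[OF bisection_subset] by (intro sums) auto
    ultimately show ?thesis using inv[OF bis] sums_unique2 by auto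
  qed
  then show ?thesis using p sets by (simp add: invariant_measures_def)
qed

text \<open>In the limit the error term vanishes, which leaves only one inequality between the
  measures of source and range. The same inequality for the inverse bisection is the other
  one.\<close>

lemma invariant_measure_from_orbits:
  assumes K: "\<And>n. elementary_subgroupoid X G0 r s mul iv (K n)"
    and inv: "\<And>W. bisection W \<Longrightarrow> \<exists>N. \<forall>n\<ge>N. \<forall>x\<in>G0.
       real (card (orbit (K n) x \<inter> s ` W)) / real (card (orbit (K n) x))
       \<le> real (card (orbit (K n) x \<inter> r ` W)) / real (card (orbit (K n) x)) + 1 / real (Suc n)"
    and y: "\<And>n. y n \<in> G0"
  obtains \<rho> :: "nat \<Rightarrow> nat" and \<mu> where "strict_mono \<rho>" "\<mu> \<in> invariant_measures X G0 r s"
    "\<And>A. \<lbrakk>compact_open A; A \<subseteq> G0\<rbrakk> \<Longrightarrow>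
       (\<lambda>n. real (card (orbit (K (\<rho> n)) (y (\<rho> n)) \<inter> A)) / real (card (orbit (K (\<rho> n)) (y (\<rho> n)))))
         \<longlonglongrightarrow> measure \<mu> A"
proof -
  define Q where "Q n = orbit (K n) (y n)" for n
  have Q: "finite (Q n)" "Q n \<subseteq> G0" for n
    using finite_orbit[OF K[of n], of "y n"] r_image_units[of "{k \<in> K n. s k = y n}"]
      compact_open_subset[OF elementary_compact_open[OF K[of n]]] by (auto simp: Q_def)
  have "Q n \<noteq> {}" for n
    using y[of n] K[of n] by (auto simp: Q_def elementary_subgroupoid_def)
  then obtain \<rho> :: "nat \<Rightarrow> nat" and \<mu> where \<rho>: "strict_mono \<rho>" and \<mu>: "prob_space \<mu>"
    "sets \<mu> = sets (sigma G0 {V. openin (subtopology X G0) V})"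
    and lim: "\<And>A. \<lbrakk>compact_open A; A \<subseteq> G0\<rbrakk> \<Longrightarrow>
       (\<lambda>n. real (card (Q (\<rho> n) \<inter> A)) / real (card (Q (\<rho> n)))) \<longlonglongrightarrow> measure \<mu> A"
    by (rule limit_measure[of Q, OF Q(1) _ Q(2)]) blast+
  have le: "measure \<mu> (s ` W) \<le> measure \<mu> (r ` W)" if W: "bisection W" for W
  proof -
    have cl: "compact_open (s ` W)" "s ` W \<subseteq> G0" "compact_open (r ` W)" "r ` W \<subseteq> G0"
      using compact_open_s_image compact_open_r_image bisection_compact_open[OF W]
        s_image_units r_image_units bisection_subset[OF W] by auto
    have "(\<lambda>n. 1 / real (Suc (\<rho> n))) \<longlonglongrightarrow> 0"
      using LIMSEQ_subseq_LIMSEQ[OF LIMSEQ_inverse_real_of_nat \<rho>]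
      by (simp add: comp_def inverse_eq_divide)
    then have lim': "(\<lambda>n. real (card (Q (\<rho> n) \<inter> r ` W)) / real (card (Q (\<rho> n))) + 1 / real (Suc (\<rho> n)))
        \<longlonglongrightarrow> measure \<mu> (r ` W) + 0"
      using tendsto_add[OF lim[OF cl(3,4)]] by blast
    obtain N where N: "\<And>n x. n \<ge> N \<Longrightarrow> x \<in> G0 \<Longrightarrow>
       real (card (orbit (K n) x \<inter> s ` W)) / real (card (orbit (K n) x))
       \<le> real (card (orbit (K n) x \<inter> r ` W)) / real (card (orbit (K n) x)) + 1 / real (Suc n)"
      using inv[OF W] by blast
    have "real (card (Q (\<rho> n) \<inter> s ` W)) / real (card (Q (\<rho> n)))
        \<le> real (card (Q (\<rho> n) \<inter> r ` W)) / real (card (Q (\<rho> n))) + 1 / real (Suc (\<rho> n))" if "n \<ge> N" for n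
      unfolding Q_def using N[OF _ y] seq_suble[OF \<rho>, of n] that by (meson order_trans)
    then have "measure \<mu> (s ` W) \<le> measure \<mu> (r ` W) + 0"
      using LIMSEQ_le[OF lim[OF cl(1,2)] lim'] by blast
    then show ?thesis by simp
  qed
  have "measure \<mu> (r ` W) = measure \<mu> (s ` W)" if W: "bisection W" for W
    using le[OF W] le[OF bisection_iv_image[OF W]] bisection_subset[OF W]
    by (simp add: r_iv_image s_iv_image)
  then have "\<mu> \<in> invariant_measures X G0 r s"
    using invariant_measureI \<mu> by blast
  then show ?thesis using that \<rho> lim by (simp add: Q_def)
qed

lemma invariant_measures_nonempty:
  assumes af: "almost_finite X G0 r s mul iv" and "G0 \<noteq> {}"
  shows "invariant_measures X G0 r s \<noteq> {}"
proof -
  obtain x where x: "x \<in> G0" using assms by blast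
  obtain K where K: "\<And>n. elementary_subgroupoid X G0 r s mul iv (K n)"
    "\<And>W. bisection W \<Longrightarrow> \<exists>N. \<forall>n\<ge>N. \<forall>x\<in>G0.
       real (card (orbit (K n) x \<inter> s ` W)) / real (card (orbit (K n) x))
       \<le> real (card (orbit (K n) x \<inter> r ` W)) / real (card (orbit (K n) x)) + 1 / real (Suc n)"
    using almost_finite_sequence[OF af] by blast
  show ?thesis
    using invariant_measure_from_orbits[OF K, of "\<lambda>_. x"] x by blast
qed

text \<open>If no \<open>K n\<close> admits a matching, each has an orbit on which \<open>B\<close>
  has at most as many points as \<open>A\<close>. A limit measure along these orbits is invariant
  and gives \<open>B\<close> at most the measure of \<open>A\<close>, against the
  hypothesis.\<close>

lemma comparison:
  assumes af: "almost_finite X G0 r s mul iv"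
    and A: "compact_open A" "A \<subseteq> G0" and B: "compact_open B" "B \<subseteq> G0"
    and less: "\<And>\<mu>. \<mu> \<in> invariant_measures X G0 r s \<Longrightarrow> measure \<mu> A < measure \<mu> B"
  shows "\<exists>T. bisection T \<and> s ` T = A \<and> r ` T \<subseteq> B"
proof (rule ccontr)
  assume none: "\<not> ?thesis"
  obtain K where K: "\<And>n. elementary_subgroupoid X G0 r s mul iv (K n)"
    "\<And>W. bisection W \<Longrightarrow> \<exists>N. \<forall>n\<ge>N. \<forall>x\<in>G0.
       real (card (orbit (K n) x \<inter> s ` W)) / real (card (orbit (K n) x))
       \<le> real (card (orbit (K n) x \<inter> r ` W)) / real (card (orbit (K n) x)) + 1 / real (Suc n)"
    using almost_finite_sequence[OF af] by blast
  have "\<exists>x\<in>G0. card (orbit (K n) x \<inter> B) \<le> card (orbit (K n) x \<inter> A)" for n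
    using matching_from_orbit_counts[OF K(1)[of n] A B(1)] none by (meson nle_le)
  then have "\<forall>n. \<exists>x. x \<in> G0 \<and> card (orbit (K n) x \<inter> B) \<le> card (orbit (K n) x \<inter> A)" by blast
  then obtain y where "\<forall>n. y n \<in> G0 \<and> card (orbit (K n) (y n) \<inter> B) \<le> card (orbit (K n) (y n) \<inter> A)"
    by (rule choice[THEN exE])
  then have y: "\<And>n. y n \<in> G0"
    "\<And>n. card (orbit (K n) (y n) \<inter> B) \<le> card (orbit (K n) (y n) \<inter> A)" by blast+
  obtain \<rho> :: "nat \<Rightarrow> nat" and \<mu> where \<mu>: "\<mu> \<in> invariant_measures X G0 r s"
    and lim: "\<And>A. \<lbrakk>compact_open A; A \<subseteq> G0\<rbrakk> \<Longrightarrow>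
       (\<lambda>n. real (card (orbit (K (\<rho> n)) (y (\<rho> n)) \<inter> A)) / real (card (orbit (K (\<rho> n)) (y (\<rho> n)))))
         \<longlonglongrightarrow> measure \<mu> A"
    by (rule invariant_measure_from_orbits[of K y, OF K y(1)]) blast+
  have "real (card (orbit (K n) (y n) \<inter> B)) / real (card (orbit (K n) (y n)))
      \<le> real (card (orbit (K n) (y n) \<inter> A)) / real (card (orbit (K n) (y n)))" for n
    using y(2)[of n] by (intro divide_right_mono) auto
  then have "measure \<mu> B \<le> measure \<mu> A"
    using LIMSEQ_le[OF lim[OF B] lim[OF A]] by blast
  then show False using less[OF \<mu>] by simp
qed

subsection \<open>Back and forth\<close>

lemma minimal_arrow:
  assumes min: "minimal_groupoid X G0 r s" and x: "x \<in> G0" and A: "openin X A" "A \<subseteq> G0" "A \<noteq> {}"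
  obtains g where "g \<in> topspace X" "s g = x" "r g \<in> A"
proof -
  obtain a where a: "a \<in> A" using A by blast
  then have "a \<in> (subtopology X G0) closure_of (r ` {g\<in>topspace X. s g = x})"
    using min x A by (auto simp: minimal_groupoid_def)
  moreover have "openin (subtopology X G0) A" using A openin_units_iff by blast
  ultimately obtain y where "y \<in> r ` {g\<in>topspace X. s g = x}" "y \<in> A"
    using a unfolding in_closure_of by blast
  then show ?thesis using that by blast
qed

lemma bisection_into:
  assumes g: "g \<in> topspace X" "r g \<in> A" and A: "openin X A"
  obtains W where "bisection W" "g \<in> W" "r ` W \<subseteq> A"
proof -
  have "openin X {h \<in> topspace X. r h \<in> A}"
    using openin_continuous_map_preimage[OF continuous_r A] .
  then obtain W where "bisection W" "g \<in> W" "W \<subseteq> {h \<in> topspace X. r h \<in> A}"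
    using bisection_nbhd[of "{h \<in> topspace X. r h \<in> A}" g] g by auto
  then show ?thesis using that by blast
qed

text \<open>By minimality every unit has an arrow into \<open>A\<close>, so by compactness the
  sources of finitely many bisections with range in \<open>A\<close> cover \<open>G0\<close>. If
  \<open>A\<close> were null, all these sources and hence \<open>G0\<close> would be null.\<close>

lemma invariant_measure_pos:
  assumes min: "minimal_groupoid X G0 r s" and A: "compact_open A" "A \<subseteq> G0" "A \<noteq> {}"
    and \<mu>: "\<mu> \<in> invariant_measures X G0 r s"
  shows "measure \<mu> A > 0"
proof (rule ccontr)
  interpret prob_space \<mu> using \<mu> by (rule invariant_measure_prob_space)
  assume "\<not> measure \<mu> A > 0"
  then have A0: "measure \<mu> A = 0" using measure_nonneg[of \<mu> A] by linarith
  have As: "A \<in> sets \<mu>" using clopen_in_sets[OF \<mu>] A by blast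
  let ?\<W> = "{W. bisection W \<and> r ` W \<subseteq> A}"
  have "G0 \<subseteq> \<Union>((`) s ` ?\<W>)"
  proof
    fix x assume x: "x \<in> G0"
    obtain g where g: "g \<in> topspace X" "s g = x" "r g \<in> A"
      using minimal_arrow[OF min x compact_open_openin[OF A(1)] A(2,3)] by blast
    obtain W where "bisection W" "g \<in> W" "r ` W \<subseteq> A"
      using bisection_into[OF g(1,3) compact_open_openin[OF A(1)]] by blast
    then show "x \<in> \<Union>((`) s ` ?\<W>)" using g by blast
  qed
  moreover have "\<And>S. S \<in> (`) s ` ?\<W> \<Longrightarrow> openin X S"
    using openin_s_image bisection_compact_open compact_open_openin by blast
  ultimately obtain F where F: "finite F" "F \<subseteq> (`) s ` ?\<W>" "G0 \<subseteq> \<Union>F"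
    using compactinD[OF compact_open_compactin[OF compact_open_units]] by meson
  have null: "S \<in> sets \<mu> \<and> measure \<mu> S = 0 \<and> S \<subseteq> G0" if S: "S \<in> F" for S
  proof -
    obtain W where W: "bisection W" "r ` W \<subseteq> A" "S = s ` W" using S F(2) by blast
    have "compact_open S" "S \<subseteq> G0"
      using W compact_open_s_image bisection_compact_open s_image_units bisection_subset by auto
    moreover have "measure \<mu> S \<le> measure \<mu> A"
      using measure_bisection[OF \<mu> W(1)] W finite_measure_mono[OF W(2) As] by simp
    ultimately show ?thesis
      using A0 measure_nonneg[of \<mu> S] clopen_in_sets[OF \<mu>] by auto
  qed
  then have "G0 = (\<Union>S\<in>F. S)" using F(3) by auto
  moreover have "measure \<mu> (\<Union>S\<in>F. S) \<le> (\<Sum>S\<in>F. measure \<mu> S)"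
    using F(1) null by (intro finite_measure_subadditive_finite) auto
  ultimately have "measure \<mu> G0 \<le> 0" using null by simp
  then show False using prob_space space_invariant_measure[OF \<mu>] by simp
qed

text \<open>Two arrows from \<open>y\<close> end at different points of \<open>A\<close>. Bisections
  around them carry a neighbourhood of \<open>y\<close> into disjoint parts of \<open>A\<close>, so
  its measure is at most half that of \<open>A\<close>, which is positive. The neighbourhood does
  not depend on the measure.\<close>

lemma small_neighbourhood:
  assumes min: "minimal_groupoid X G0 r s" and perfect: "\<And>x. x \<in> G0 \<Longrightarrow> \<not> openin X {x}"
    and A: "compact_open A" "A \<subseteq> G0" "A \<noteq> {}" and y: "y \<in> G0"
  obtains N where "compact_open N" "N \<subseteq> G0" "y \<in> N"
    "\<And>\<mu>. \<mu> \<in> invariant_measures X G0 r s \<Longrightarrow> measure \<mu> N < measure \<mu> A"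
proof -
  have oA: "openin X A" using compact_open_openin[OF A(1)] .
  obtain g1 where g1: "g1 \<in> topspace X" "s g1 = y" "r g1 \<in> A"
    using minimal_arrow[OF min y oA A(2,3)] by blast
  have "r g1 \<in> G0" using g1 by simp
  have "openin X (A - {r g1})"
    using closedin_Hausdorff_singleton[OF Hausdorff] g1 A(2) units_subset openin_diff[OF oA] by blast
  \<comment> \<open>Here the absence of isolated units enters: it keeps \<open>A\<close> from being
    the single point \<open>r g1\<close>, so a second endpoint exists.\<close>
  moreover have "A - {r g1} \<noteq> {}"
  proof
    assume "A - {r g1} = {}"
    then have "A = {r g1}" using g1 by blast
    then show False using perfect[OF \<open>r g1 \<in> G0\<close>] oA by simp
  qed
  ultimately obtain g2 where g2: "g2 \<in> topspace X" "s g2 = y" "r g2 \<in> A - {r g1}"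
    using minimal_arrow[OF min y, of "A - {r g1}"] A(2) by blast
  obtain A2 where A2: "compact_open A2" "r g2 \<in> A2" "A2 \<subseteq> A - {r g1}"
    using clopen_nbhd[OF \<open>openin X (A - {r g1})\<close> _ g2(3)] A(2) by blast
  define A1 where "A1 = A - A2"
  have A1: "compact_open A1" "r g1 \<in> A1" using A A2 g1 compact_open_Diff by (auto simp: A1_def)
  obtain W1 where W1: "bisection W1" "g1 \<in> W1" "r ` W1 \<subseteq> A1"
    using bisection_into[OF g1(1) A1(2) compact_open_openin[OF A1(1)]] by blast
  obtain W2 where W2: "bisection W2" "g2 \<in> W2" "r ` W2 \<subseteq> A2"
    using bisection_into[OF g2(1) A2(2) compact_open_openin[OF A2(1)]] by blast
  define N where "N = s ` W1 \<inter> s ` W2"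
  have co: "compact_open (s ` W1)" "compact_open (s ` W2)"
    using compact_open_s_image bisection_compact_open W1 W2 by auto
  have sG: "s ` W1 \<subseteq> G0" "s ` W2 \<subseteq> G0" using s_image_units bisection_subset W1 W2 by auto
  have "measure \<mu> N < measure \<mu> A" if \<mu>: "\<mu> \<in> invariant_measures X G0 r s" for \<mu>
  proof -
    interpret prob_space \<mu> using \<mu> by (rule invariant_measure_prob_space)
    have A12: "A1 \<in> sets \<mu>" "A2 \<in> sets \<mu>" "A = A1 \<union> A2" "A1 \<inter> A2 = {}"
      using clopen_in_sets[OF \<mu>] A1 A2 A(2) by (auto simp: A1_def)
    have "measure \<mu> N \<le> measure \<mu> (s ` W1)"
      using clopen_in_sets[OF \<mu> co(1) sG(1)] by (intro finite_measure_mono) (auto simp: N_def)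
    also have "\<dots> \<le> measure \<mu> A1"
      using measure_bisection[OF \<mu> W1(1)] finite_measure_mono[OF W1(3) A12(1)] by simp
    finally have 1: "measure \<mu> N \<le> measure \<mu> A1" .
    have "measure \<mu> N \<le> measure \<mu> (s ` W2)"
      using clopen_in_sets[OF \<mu> co(2) sG(2)] by (intro finite_measure_mono) (auto simp: N_def)
    also have "\<dots> \<le> measure \<mu> A2"
      using measure_bisection[OF \<mu> W2(1)] finite_measure_mono[OF W2(3) A12(2)] by simp
    finally have 2: "measure \<mu> N \<le> measure \<mu> A2" .
    have "measure \<mu> A = measure \<mu> A1 + measure \<mu> A2"
      using A12 finite_measure_Union by simp
    then show ?thesis using 1 2 invariant_measure_pos[OF min A \<mu>] by linarith
  qed
  moreover have "compact_open N" "N \<subseteq> G0"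
    using co sG compact_open_Int by (auto simp: N_def)
  moreover have "y \<in> N" using imageI[OF W1(2), of s] imageI[OF W2(2), of s] g1(2) g2(2) by (simp add: N_def)
  ultimately show ?thesis using that by blast
qed

text \<open>This is one half of a back-and-forth stage. Comparison needs a strict inequality: the
  unmatched part \<open>P\<close> of \<open>U\<close> inside \<open>c\<close> is left aside, while
  on the other side only a neighbourhood \<open>N\<close> of \<open>y0\<close> with smaller measure
  than \<open>P\<close> is sacrificed.\<close>

lemma extend_matching:
  assumes af: "almost_finite X G0 r s mul iv" and min: "minimal_groupoid X G0 r s"
    and perfect: "\<And>x. x \<in> G0 \<Longrightarrow> \<not> openin X {x}"
    and U: "compact_open U" "U \<subseteq> G0" "x0 \<in> U" and V: "compact_open V" "V \<subseteq> G0" "y0 \<in> V"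
    and eq: "\<And>\<mu>. \<mu> \<in> invariant_measures X G0 r s \<Longrightarrow> measure \<mu> U = measure \<mu> V"
    and T: "bisection T" "s ` T \<subseteq> U - {x0}" "r ` T \<subseteq> V - {y0}"
    and c: "compact_open c" "x0 \<in> c"
  shows "\<exists>T'. bisection T' \<and> T \<subseteq> T' \<and> s ` T' \<subseteq> U - {x0} \<and> r ` T' \<subseteq> V - {y0} \<and> U - c \<subseteq> s ` T'"
proof -
  have cs: "compact_open (s ` T)" "compact_open (r ` T)"
    using T(1) bisection_compact_open compact_open_s_image compact_open_r_image by auto
  \<comment> \<open>This set is nonempty because it contains \<open>x0\<close>, which is never
    matched.\<close>
  define P where "P = (U - s ` T) \<inter> c"
  have P: "compact_open P" "P \<subseteq> G0" "P \<noteq> {}"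
    using U T(2) c cs unfolding P_def by (blast intro: compact_open_Int compact_open_Diff)+
  have "y0 \<in> G0" using V by blast
  then obtain N where N: "compact_open N" "N \<subseteq> G0" "y0 \<in> N"
    "\<And>\<mu>. \<mu> \<in> invariant_measures X G0 r s \<Longrightarrow> measure \<mu> N < measure \<mu> P"
    using small_neighbourhood[OF min perfect P] by blast
  define A where "A = U - s ` T - c"
  define B where "B = V - r ` T - N"
  have A: "compact_open A" "A \<subseteq> G0" using U cs c by (auto simp: A_def intro: compact_open_Diff)
  have B: "compact_open B" "B \<subseteq> G0" using V cs N by (auto simp: B_def intro: compact_open_Diff)
  \<comment> \<open>Removing \<open>T\<close> takes equal measure from \<open>U\<close> and
    \<open>V\<close>. What remains of \<open>U\<close> loses \<open>P\<close>, and what remains of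
    \<open>V\<close> loses at most the measure of \<open>N\<close>, which is less.\<close>
  have "measure \<mu> A < measure \<mu> B" if \<mu>: "\<mu> \<in> invariant_measures X G0 r s" for \<mu>
  proof -
    interpret prob_space \<mu> using \<mu> by (rule invariant_measure_prob_space)
    note S = clopen_in_sets[OF \<mu>]
    have sets: "U \<in> sets \<mu>" "V \<in> sets \<mu>" "s ` T \<in> sets \<mu>" "r ` T \<in> sets \<mu>" "P \<in> sets \<mu>"
      "N \<in> sets \<mu>" "A \<in> sets \<mu>" "B \<in> sets \<mu>"
      using S[OF U(1,2)] S[OF V(1,2)] S[OF cs(1)] S[OF cs(2)] S[OF P(1,2)] S[OF N(1,2)] S[OF A] S[OF B]
        s_image_units r_image_units bisection_subset[OF T(1)] by simp_all
    have "measure \<mu> (A \<union> P) = measure \<mu> A + measure \<mu> P"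
      using sets by (intro finite_measure_Union) (auto simp: A_def P_def)
    moreover have "A \<union> P = U - s ` T" by (auto simp: A_def P_def)
    moreover have "measure \<mu> (U - s ` T) = measure \<mu> U - measure \<mu> (s ` T)"
      using sets T(2) by (intro finite_measure_Diff) auto
    moreover have "measure \<mu> (V - r ` T) = measure \<mu> V - measure \<mu> (r ` T)"
      using sets T(3) by (intro finite_measure_Diff) auto
    moreover have "measure \<mu> (V - r ` T) \<le> measure \<mu> (B \<union> N)"
      using sets by (intro finite_measure_mono) (auto simp: B_def)
    moreover have "measure \<mu> (B \<union> N) = measure \<mu> B + measure \<mu> N"
      using sets by (intro finite_measure_Union) (auto simp: B_def)
    ultimately show ?thesis
      using N(4)[OF \<mu>] eq[OF \<mu>] measure_bisection[OF \<mu> T(1)] by simp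
  qed
  then obtain T1 where T1: "bisection T1" "s ` T1 = A" "r ` T1 \<subseteq> B"
    using comparison[OF af A B] by blast
  have "inj_on r (T \<union> T1)" "inj_on s (T \<union> T1)"
    using bisection_inj_r[OF T(1)] bisection_inj_r[OF T1(1)] bisection_inj_s[OF T(1)]
      bisection_inj_s[OF T1(1)] T1(2,3) unfolding inj_on_Un A_def B_def by blast+
  then have "bisection (T \<union> T1)"
    using T(1) T1(1) compact_open_Un by (simp add: bisection_def)
  moreover have "s ` (T \<union> T1) \<subseteq> U - {x0}" "r ` (T \<union> T1) \<subseteq> V - {y0}" "U - c \<subseteq> s ` (T \<union> T1)"
    using T T1(2,3) N(3) c(2) unfolding image_Un A_def B_def by blast+
  ultimately show ?thesis by blast
qed

text \<open>Stage \<open>n\<close> deals with the \<open>n\<close>-th set of an enumeration of all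
  compact open sets, first as a neighbourhood of \<open>x0\<close>, then of \<open>y0\<close>. As
  every such set is enumerated, the matchings exhaust the complements of all clopen
  neighbourhoods.\<close>

lemma matching_sequence:
  assumes af: "almost_finite X G0 r s mul iv" and min: "minimal_groupoid X G0 r s"
    and perfect: "\<And>x. x \<in> G0 \<Longrightarrow> \<not> openin X {x}"
    and U: "compact_open U" "U \<subseteq> G0" "x0 \<in> U" and V: "compact_open V" "V \<subseteq> G0" "y0 \<in> V"
    and eq: "\<And>\<mu>. \<mu> \<in> invariant_measures X G0 r s \<Longrightarrow> measure \<mu> U = measure \<mu> V"
  obtains T :: "nat \<Rightarrow> 'g set" where "incseq T" "\<And>n. bisection (T n)"
    "\<And>n. s ` T n \<subseteq> U - {x0}" "\<And>n. r ` T n \<subseteq> V - {y0}"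
    "\<And>c. compact_open c \<Longrightarrow> x0 \<in> c \<Longrightarrow> \<exists>n. U - c \<subseteq> s ` T n"
    "\<And>c. compact_open c \<Longrightarrow> y0 \<in> c \<Longrightarrow> \<exists>n. V - c \<subseteq> r ` T n"
proof -
  obtain c :: "nat \<Rightarrow> 'g set" where c: "range c = {W. compact_open W}"
    using range_from_nat_into[OF _ countable_compact_open] compact_open_empty by blast
  have cc: "compact_open (c n)" for n using c by auto
  define P where "P T \<longleftrightarrow> bisection T \<and> s ` T \<subseteq> U - {x0} \<and> r ` T \<subseteq> V - {y0}" for T
  define R where "R n T T' \<longleftrightarrow> T \<subseteq> T' \<and> (x0 \<in> c n \<longrightarrow> U - c n \<subseteq> s ` T') \<and>
      (y0 \<in> c n \<longrightarrow> V - c n \<subseteq> r ` T')" for n T T'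
  have "\<exists>T. \<forall>n. P (T n) \<and> R n (T n) (T (Suc n))"
  proof (rule dependent_nat_choice)
    show "\<exists>T. P T" by (rule exI[of _ "{}"]) (simp add: P_def)
  next
    fix T n assume T: "P T"
    have "\<exists>T'. P T' \<and> T \<subseteq> T' \<and> (x0 \<in> c n \<longrightarrow> U - c n \<subseteq> s ` T')"
    proof (cases "x0 \<in> c n")
      case True
      have "bisection T" "s ` T \<subseteq> U - {x0}" "r ` T \<subseteq> V - {y0}" using T by (auto simp: P_def)
      from extend_matching[OF af min perfect U V eq this cc[of n] True] show ?thesis
        unfolding P_def by blast
    qed (use T in blast)
    then obtain T1 where T1: "P T1" "T \<subseteq> T1" "x0 \<in> c n \<longrightarrow> U - c n \<subseteq> s ` T1" by blast
    show "\<exists>T'. P T' \<and> R n T T'"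
    proof (cases "y0 \<in> c n")
      case True
      have T1X: "T1 \<subseteq> topspace X" using T1(1) bisection_subset by (simp add: P_def)
      \<comment> \<open>Inversion exchanges the roles of \<open>U\<close> and \<open>V\<close>, so
        the same extension lemma serves the other side.\<close>
      have "bisection (iv ` T1)" "s ` iv ` T1 \<subseteq> V - {y0}" "r ` iv ` T1 \<subseteq> U - {x0}"
        using T1(1) bisection_iv_image r_iv_image[OF T1X] s_iv_image[OF T1X] by (simp_all add: P_def)
      from extend_matching[OF af min perfect V U eq[symmetric] this cc[of n] True]
      obtain T2 where T2: "bisection T2" "iv ` T1 \<subseteq> T2" "s ` T2 \<subseteq> V - {y0}"
          "r ` T2 \<subseteq> U - {x0}" "V - c n \<subseteq> s ` T2" by blast
      have T2X: "T2 \<subseteq> topspace X" using T2(1) bisection_subset by simp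
      have "T1 \<subseteq> iv ` T2"
      proof
        fix t assume "t \<in> T1"
        then have "iv t \<in> T2" "t = iv (iv t)" using T2(2) T1X by auto
        then show "t \<in> iv ` T2" by blast
      qed
      then have "R n T (iv ` T2)"
        using T1(2,3) T2(5) r_iv_image[OF T2X] image_mono[of T1 "iv ` T2" s] unfolding R_def
        by (metis order_trans)
      moreover have "P (iv ` T2)"
        using T2 bisection_iv_image s_iv_image[OF T2X] r_iv_image[OF T2X] by (simp add: P_def)
      ultimately show ?thesis by blast
    next
      case False
      then have "R n T T1" using T1(2,3) by (simp add: R_def)
      then show ?thesis using T1(1) by blast
    qed
  qed
  then obtain T where T: "\<And>n. P (T n)" "\<And>n. R n (T n) (T (Suc n))" by blast
  have "incseq T" using T(2) by (intro incseq_SucI) (simp add: R_def)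
  moreover have "\<exists>n. U - d \<subseteq> s ` T n" if d: "compact_open d" "x0 \<in> d" for d
  proof -
    obtain n where "d = c n" using c d by blast
    then show ?thesis using T(2)[of n] d by (auto simp: R_def)
  qed
  moreover have "\<exists>n. V - d \<subseteq> r ` T n" if d: "compact_open d" "y0 \<in> d" for d
  proof -
    obtain n where "d = c n" using c d by blast
    then show ?thesis using T(2)[of n] d by (auto simp: R_def)
  qed
  moreover have "bisection (T n)" "s ` T n \<subseteq> U - {x0}" "r ` T n \<subseteq> V - {y0}" for n
    using T(1)[of n] by (simp_all add: P_def)
  ultimately show ?thesis using that[of T] by simp
qed

section \<open>From matchings to involutions in the full group\<close>

text \<open>The arrows of \<open>T\<close> and the arrow \<open>g0\<close> exchange their end
  points, and all other units are fixed. The hypotheses \<open>lim_s\<close> and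
  \<open>lim_r\<close> are continuity at the two exceptional points, and \<open>g0\<close> itself is
  the arrow required there by the full group. Being its own inverse, the map is a homeomorphism once
  it is continuous.\<close>

lemma swapping_involution:
  assumes U: "openin X U" "U \<subseteq> G0" and V: "openin X V" "V \<subseteq> G0" and disj: "U \<inter> V = {}"
    and rest: "openin X (G0 - (U \<union> V))"
    and T: "openin X T" "inj_on r T" "inj_on s T"
    and sT: "s ` T = U - {s g0}" and rT: "r ` T = V - {r g0}"
    and g0: "g0 \<in> topspace X" "s g0 \<in> U" "r g0 \<in> V"
    and lim_s: "\<And>M. \<lbrakk>openin X M; r g0 \<in> M\<rbrakk> \<Longrightarrow>
      \<exists>N. openin X N \<and> s g0 \<in> N \<and> N \<subseteq> U \<and> (\<forall>t\<in>T. s t \<in> N \<longrightarrow> r t \<in> M)"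
    and lim_r: "\<And>M. \<lbrakk>openin X M; s g0 \<in> M\<rbrakk> \<Longrightarrow>
      \<exists>N. openin X N \<and> r g0 \<in> N \<and> N \<subseteq> V \<and> (\<forall>t\<in>T. r t \<in> N \<longrightarrow> s t \<in> M)"
  shows "\<exists>\<gamma>\<in>full_group X G0 r s. \<gamma> ` U = V \<and> \<gamma> ` V = U \<and>
           (\<forall>x\<in>G0. \<gamma> (\<gamma> x) = x) \<and> (\<forall>x\<in>G0 - (U \<union> V). \<gamma> x = x)"
proof -
  have TX: "T \<subseteq> topspace X" using T(1) openin_subset by blast
  define \<gamma> where "\<gamma> x =
     (if x \<in> s ` T then r (the_inv_into T s x) else if x \<in> r ` T then s (the_inv_into T r x)
      else if x = s g0 then r g0 else if x = r g0 then s g0 else x)" for x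
  have tU: "s t \<in> U" "s t \<noteq> s g0" "r t \<in> V" "r t \<noteq> r g0" if "t \<in> T" for t
    using that sT rT by auto
  have \<gamma>s: "\<gamma> (s t) = r t" if t: "t \<in> T" for t
    using the_inv_into_f_f[OF T(3) t] t by (simp add: \<gamma>_def)
  have \<gamma>r: "\<gamma> (r t) = s t" if t: "t \<in> T" for t
  proof -
    have "r t \<notin> s ` T" using tU[OF t] sT disj by auto
    then show ?thesis using the_inv_into_f_f[OF T(2) t] t by (simp add: \<gamma>_def)
  qed
  have \<gamma>sg: "\<gamma> (s g0) = r g0" and \<gamma>rg: "\<gamma> (r g0) = s g0"
    using sT rT g0 disj by (auto simp: \<gamma>_def)
  have \<gamma>id: "\<gamma> x = x" if "x \<notin> U \<union> V" for x
    using that sT rT g0 by (auto simp: \<gamma>_def)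
  have Ucases: thesis if "x \<in> U" "\<And>t. t \<in> T \<Longrightarrow> x = s t \<Longrightarrow> thesis" "x = s g0 \<Longrightarrow> thesis" for x thesis
    using that sT by blast
  have Vcases: thesis if "x \<in> V" "\<And>t. t \<in> T \<Longrightarrow> x = r t \<Longrightarrow> thesis" "x = r g0 \<Longrightarrow> thesis" for x thesis
    using that rT by blast
  have UV: "\<gamma> x \<in> V \<and> \<gamma> (\<gamma> x) = x \<and> (\<exists>g\<in>topspace X. r g = x \<and> s g = \<gamma> x)" if "x \<in> U" for x
    using that
  proof (rule Ucases)
    fix t assume t: "t \<in> T" "x = s t"
    then have "iv t \<in> topspace X" "r (iv t) = x" "s (iv t) = r t" using TX by auto
    then show ?thesis using t \<gamma>s \<gamma>r tU by metis
  next
    assume "x = s g0"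
    moreover have "iv g0 \<in> topspace X" "r (iv g0) = s g0" "s (iv g0) = r g0" using g0 by auto
    ultimately show ?thesis using \<gamma>sg \<gamma>rg g0 by metis
  qed
  have VU: "\<gamma> x \<in> U \<and> \<gamma> (\<gamma> x) = x \<and> (\<exists>g\<in>topspace X. r g = x \<and> s g = \<gamma> x)" if "x \<in> V" for x
    using that
  proof (rule Vcases)
    fix t assume t: "t \<in> T" "x = r t"
    then have "t \<in> topspace X" using TX by blast
    then show ?thesis using t \<gamma>s \<gamma>r tU by metis
  next
    assume "x = r g0"
    then show ?thesis using \<gamma>sg \<gamma>rg g0 by metis
  qed
  have inv: "\<gamma> (\<gamma> x) = x" for x
    using UV VU \<gamma>id by (metis UnE)
  have closed: "\<gamma> x \<in> G0" if "x \<in> G0" for x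
  proof (cases "x \<in> U \<union> V")
    case True
    then show ?thesis using UV VU U(2) V(2) by blast
  next
    case False
    then show ?thesis using \<gamma>id that by simp
  qed
  have arrows: "\<exists>g\<in>topspace X. r g = x \<and> s g = \<gamma> x" if x: "x \<in> G0" for x
  proof (cases "x \<in> U \<union> V")
    case True
    then show ?thesis using UV VU by blast
  next
    case False
    then have "r x = x \<and> s x = \<gamma> x" using \<gamma>id x by simp
    then show ?thesis using x units_subset by blast
  qed
  have "\<gamma> ` U \<subseteq> V" "\<gamma> ` V \<subseteq> U" using UV VU by blast+
  then have swap: "\<gamma> ` U = V" "\<gamma> ` V = U"
    using inv by (metis image_eqI image_subset_iff subsetI subset_antisym)+
  have top: "topspace (subtopology X G0) = G0" using units_subset by auto
  have "openin X {x \<in> G0. \<gamma> x \<in> M}" if M: "openin X M" for M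
  proof (subst openin_subopen, intro ballI)
    fix x assume "x \<in> {x \<in> G0. \<gamma> x \<in> M}"
    then have x: "x \<in> G0" "\<gamma> x \<in> M" by auto
    show "\<exists>N. openin X N \<and> x \<in> N \<and> N \<subseteq> {x \<in> G0. \<gamma> x \<in> M}"
    proof (cases "x \<in> U")
      case True
      then show ?thesis
      proof (rule Ucases)
        fix t assume t: "t \<in> T" "x = s t"
        \<comment> \<open>Near the source of an arrow \<open>t\<close> of \<open>T\<close> the map
          is given by \<open>T\<close> itself, and \<open>T\<close> has open source images.\<close>
        define N where "N = s ` (T \<inter> {g \<in> topspace X. r g \<in> M})"
        have "openin X N"
          unfolding N_def using openin_continuous_map_preimage[OF continuous_r M] T(1)
          by (intro openin_s_image) blast
        moreover have "x \<in> N" using t x(2) \<gamma>s[OF t(1)] TX by (auto simp: N_def)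
        moreover have "N \<subseteq> {x \<in> G0. \<gamma> x \<in> M}" using \<gamma>s by (auto simp: N_def)
        ultimately show ?thesis by blast
      next
        assume x0: "x = s g0"
        then obtain N where N: "openin X N" "s g0 \<in> N" "N \<subseteq> U" "\<forall>t\<in>T. s t \<in> N \<longrightarrow> r t \<in> M"
          using lim_s[OF M] x(2) \<gamma>sg by auto
        have "\<gamma> z \<in> M" if z: "z \<in> N" for z
        proof (rule Ucases[of z])
          show "z \<in> U" using z N(3) by blast
        next
          fix t assume "t \<in> T" "z = s t"
          then show ?thesis using \<gamma>s N(4) z by simp
        next
          assume "z = s g0"
          then show ?thesis using x(2) x0 by simp
        qed
        then show ?thesis using N x0 U(2) by blast
      qed
    next
      case nU: False
      show ?thesis
      proof (cases "x \<in> V")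
        case True
        then show ?thesis
        proof (rule Vcases)
          fix t assume t: "t \<in> T" "x = r t"
          define N where "N = r ` (T \<inter> {g \<in> topspace X. s g \<in> M})"
          have "openin X N"
            unfolding N_def using openin_continuous_map_preimage[OF continuous_s M] T(1)
            by (intro openin_r_image) blast
          moreover have "x \<in> N" using t x(2) \<gamma>r[OF t(1)] TX by (auto simp: N_def)
          moreover have "N \<subseteq> {x \<in> G0. \<gamma> x \<in> M}" using \<gamma>r by (auto simp: N_def)
          ultimately show ?thesis by blast
        next
          assume y0: "x = r g0"
          then obtain N where N: "openin X N" "r g0 \<in> N" "N \<subseteq> V" "\<forall>t\<in>T. r t \<in> N \<longrightarrow> s t \<in> M"
            using lim_r[OF M] x(2) \<gamma>rg by auto
          have "\<gamma> z \<in> M" if z: "z \<in> N" for z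
          proof (rule Vcases[of z])
            show "z \<in> V" using z N(3) by blast
          next
            fix t assume "t \<in> T" "z = r t"
            then show ?thesis using \<gamma>r N(4) z by simp
          next
            assume "z = r g0"
            then show ?thesis using x(2) y0 by simp
          qed
          then show ?thesis using N y0 V(2) by blast
        qed
      next
        case False
        then have "x \<in> M \<inter> (G0 - (U \<union> V))" using nU x \<gamma>id by simp
        moreover have "openin X (M \<inter> (G0 - (U \<union> V)))" using M rest by blast
        moreover have "M \<inter> (G0 - (U \<union> V)) \<subseteq> {x \<in> G0. \<gamma> x \<in> M}" using \<gamma>id by auto
        ultimately show ?thesis by blast
      qed
    qed
  qed
  then have "continuous_map (subtopology X G0) (subtopology X G0) \<gamma>"
    unfolding continuous_map_def top using closed openin_units_iff by auto
  then have "homeomorphic_maps (subtopology X G0) (subtopology X G0) \<gamma> \<gamma>"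
    using inv by (simp add: homeomorphic_maps_def)
  then have "\<gamma> \<in> full_group X G0 r s"
    using arrows homeomorphic_map_maps[of "subtopology X G0" "subtopology X G0" \<gamma>]
    unfolding full_group_def by blast
  then show ?thesis using swap inv \<gamma>id by blast
qed

text \<open>The union \<open>S\<close> of the matchings reaches every point except
  \<open>s g0\<close> and \<open>r g0\<close>, since any other point lies outside some clopen
  neighbourhood of the exceptional one. The exhaustion also gives continuity at these two
  points.\<close>

lemma swap_perfect:
  assumes af: "almost_finite X G0 r s mul iv" and min: "minimal_groupoid X G0 r s"
    and perfect: "\<And>x. x \<in> G0 \<Longrightarrow> \<not> openin X {x}"
    and U: "compact_open U" "U \<subseteq> G0" and V: "compact_open V" "V \<subseteq> G0" and disj: "U \<inter> V = {}"
    and g0: "g0 \<in> topspace X" "s g0 \<in> U" "r g0 \<in> V"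
    and eq: "\<And>\<mu>. \<mu> \<in> invariant_measures X G0 r s \<Longrightarrow> measure \<mu> U = measure \<mu> V"
  shows "\<exists>\<gamma>\<in>full_group X G0 r s. \<gamma> ` U = V \<and> \<gamma> ` V = U \<and>
           (\<forall>x\<in>G0. \<gamma> (\<gamma> x) = x) \<and> (\<forall>x\<in>G0 - (U \<union> V). \<gamma> x = x)"
proof -
  obtain T :: "nat \<Rightarrow> 'g set" where inc: "incseq T" and bis: "\<And>n. bisection (T n)"
    and Ts: "\<And>n. s ` T n \<subseteq> U - {s g0}" and Tr: "\<And>n. r ` T n \<subseteq> V - {r g0}"
    and exh_s: "\<And>c. compact_open c \<Longrightarrow> s g0 \<in> c \<Longrightarrow> \<exists>n. U - c \<subseteq> s ` T n"
    and exh_r: "\<And>c. compact_open c \<Longrightarrow> r g0 \<in> c \<Longrightarrow> \<exists>n. V - c \<subseteq> r ` T n"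
    by (rule matching_sequence[OF af min perfect U g0(2) V g0(3) eq]) blast+
  define S where "S = (\<Union>n. T n)"
  have co: "compact_open (T n)" "compact_open (s ` T n)" "compact_open (r ` T n)" for n
    using bis bisection_compact_open compact_open_s_image compact_open_r_image by auto
  have oS: "openin X S" unfolding S_def using co compact_open_openin by blast
  have inj: "inj_on f S" if "\<And>n. inj_on f (T n)" for f
  proof (rule inj_onI)
    fix a b assume "a \<in> S" "b \<in> S" and ab: "f a = f b"
    then obtain m n where "a \<in> T m" "b \<in> T n" by (auto simp: S_def)
    then have "a \<in> T (max m n)" "b \<in> T (max m n)"
      using incseqD[OF inc, of m "max m n"] incseqD[OF inc, of n "max m n"] by auto
    then show "a = b" using that ab by (auto dest: inj_onD)
  qed
  have injr: "inj_on r S" and injs: "inj_on s S"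
    using inj bisection_inj_r bisection_inj_s bis by blast+
  have TS: "T n \<subseteq> S" for n by (auto simp: S_def)
  have sep: "\<exists>c. compact_open c \<and> z \<in> c \<and> x \<notin> c" if "z \<in> G0" "x \<in> G0" "x \<noteq> z" for x z
  proof -
    have "openin X (G0 - {x})"
      using openin_units closedin_Hausdorff_singleton[OF Hausdorff] units_subset that(2) by blast
    moreover have "z \<in> G0 - {x}" using that by blast
    ultimately obtain c where "compact_open c" "z \<in> c" "c \<subseteq> G0 - {x}"
      using clopen_nbhd by blast
    then show ?thesis by blast
  qed
  have sS: "s ` S = U - {s g0}"
  proof
    show "s ` S \<subseteq> U - {s g0}" using Ts unfolding S_def by blast
    show "U - {s g0} \<subseteq> s ` S"
    proof
      fix x assume x: "x \<in> U - {s g0}"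
      then obtain c where c: "compact_open c" "s g0 \<in> c" "x \<notin> c"
        using sep[of "s g0" x] U(2) g0 by auto
      then obtain n where "U - c \<subseteq> s ` T n" using exh_s by blast
      then show "x \<in> s ` S" using x c TS by blast
    qed
  qed
  have rS: "r ` S = V - {r g0}"
  proof
    show "r ` S \<subseteq> V - {r g0}" using Tr unfolding S_def by blast
    show "V - {r g0} \<subseteq> r ` S"
    proof
      fix x assume x: "x \<in> V - {r g0}"
      then obtain c where c: "compact_open c" "r g0 \<in> c" "x \<notin> c"
        using sep[of "r g0" x] V(2) g0 by auto
      then obtain n where "V - c \<subseteq> r ` T n" using exh_r by blast
      then show "x \<in> r ` S" using x c TS by blast
    qed
  qed
  show ?thesis
  proof (rule swapping_involution[OF _ U(2) _ V(2) disj _ oS injr injs sS rS g0])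
    show "openin X U" "openin X V" using U V compact_open_openin by auto
    show "openin X (G0 - (U \<union> V))"
      using compact_open_Diff[OF compact_open_units compact_open_Un[OF U(1) V(1)]] compact_open_openin
      by blast
  next
    fix M assume M: "openin X M" "r g0 \<in> M"
    have "openin X (M \<inter> G0)" using M openin_units by blast
    then obtain c where c: "compact_open c" "r g0 \<in> c" "c \<subseteq> M \<inter> G0"
      using clopen_nbhd[of "M \<inter> G0" "r g0"] M(2) g0(1) by auto
    then obtain n where n: "V - c \<subseteq> r ` T n" using exh_r by blast
    \<comment> \<open>At stage \<open>n\<close> all of \<open>V\<close> outside \<open>c\<close> is
      already used. An arrow of \<open>S\<close> whose source is still free at that stage can
      therefore only end inside \<open>c\<close>.\<close>
    have "r t \<in> M" if t: "t \<in> S" "s t \<in> U - s ` T n" for t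
    proof (rule ccontr)
      assume "r t \<notin> M"
      then have "r t \<in> r ` T n" using n c(3) rS t(1) by blast
      then have "t \<in> T n" using injr t(1) TS by (metis imageE inj_onD subsetD)
      then show False using t(2) by blast
    qed
    moreover have "openin X (U - s ` T n)" "s g0 \<in> U - s ` T n"
      using compact_open_Diff[OF U(1) co(2)] compact_open_openin g0(2) Ts by blast+
    ultimately show "\<exists>N. openin X N \<and> s g0 \<in> N \<and> N \<subseteq> U \<and> (\<forall>t\<in>S. s t \<in> N \<longrightarrow> r t \<in> M)" by blast
  next
    fix M assume M: "openin X M" "s g0 \<in> M"
    have "openin X (M \<inter> G0)" using M openin_units by blast
    then obtain c where c: "compact_open c" "s g0 \<in> c" "c \<subseteq> M \<inter> G0"
      using clopen_nbhd[of "M \<inter> G0" "s g0"] M(2) g0(1) by auto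
    then obtain n where n: "U - c \<subseteq> s ` T n" using exh_s by blast
    have "s t \<in> M" if t: "t \<in> S" "r t \<in> V - r ` T n" for t
    proof (rule ccontr)
      assume "s t \<notin> M"
      then have "s t \<in> s ` T n" using n c(3) sS t(1) by blast
      then have "t \<in> T n" using injs t(1) TS by (metis imageE inj_onD subsetD)
      then show False using t(2) by blast
    qed
    moreover have "openin X (V - r ` T n)" "r g0 \<in> V - r ` T n"
      using compact_open_Diff[OF V(1) co(3)] compact_open_openin g0(3) Tr by blast+
    ultimately show "\<exists>N. openin X N \<and> r g0 \<in> N \<and> N \<subseteq> V \<and> (\<forall>t\<in>S. r t \<in> N \<longrightarrow> s t \<in> M)" by blast
  qed
qed

text \<open>By minimality an isolated unit makes the unit space a single finite orbit.\<close>

lemma swap_isolated: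
  assumes min: "minimal_groupoid X G0 r s" and M: "invariant_measures X G0 r s \<noteq> {}"
    and isolated: "z \<in> G0" "openin X {z}"
    and U: "U \<subseteq> G0" and V: "V \<subseteq> G0" and disj: "U \<inter> V = {}"
    and g0: "g0 \<in> topspace X" "s g0 \<in> U" "r g0 \<in> V"
    and eq: "\<And>\<mu>. \<mu> \<in> invariant_measures X G0 r s \<Longrightarrow> measure \<mu> U = measure \<mu> V"
  shows "\<exists>\<gamma>\<in>full_group X G0 r s. \<gamma> ` U = V \<and> \<gamma> ` V = U \<and>
           (\<forall>x\<in>G0. \<gamma> (\<gamma> x) = x) \<and> (\<forall>x\<in>G0 - (U \<union> V). \<gamma> x = x)"
proof -
  \<comment> \<open>A bisection through an arrow from \<open>x\<close> to \<open>z\<close> with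
    range inside \<open>{z}\<close> is a single arrow, and its source image \<open>{x}\<close> is
    open. So one isolated unit makes all units isolated.\<close>
  have point: "openin X {x}" if x: "x \<in> G0" for x
  proof -
    obtain g where g: "g \<in> topspace X" "s g = x" "r g \<in> {z}"
      using minimal_arrow[OF min x isolated(2)] isolated(1) by blast
    obtain W where W: "bisection W" "g \<in> W" "r ` W \<subseteq> {z}"
      using bisection_into[OF g(1,3) isolated(2)] by blast
    have "w = g" if "w \<in> W" for w
      using that W bisection_inj_r[OF W(1)] by (auto simp: inj_on_def)
    then have "s ` W = {x}" using W(2) g(2) by blast
    then show ?thesis
      using openin_s_image[OF compact_open_openin[OF bisection_compact_open[OF W(1)]]] by simp
  qed
  have disc: "openin X A" if "A \<subseteq> G0" for A
  proof -
    have "openin X (\<Union>x\<in>A. {x})" using point that by (intro openin_Union) auto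
    then show ?thesis by simp
  qed
  have "finite G0"
  proof -
    have "G0 \<subseteq> \<Union>((\<lambda>x. {x}) ` G0)" by blast
    moreover have "\<And>A. A \<in> (\<lambda>x. {x}) ` G0 \<Longrightarrow> openin X A" using point by blast
    ultimately obtain F where "finite F" "F \<subseteq> (\<lambda>x. {x}) ` G0" "G0 \<subseteq> \<Union>F"
      using compactinD[OF compact_open_compactin[OF compact_open_units]] by meson
    then have "finite (\<Union>F)" by (intro finite_Union) auto
    then show ?thesis using \<open>G0 \<subseteq> \<Union>F\<close> finite_subset by blast
  qed
  then have fin: "finite U" "finite V" using U V finite_subset by auto
  have arrow: "openin X {g}" if g: "g \<in> topspace X" for g
  proof -
    obtain W where W: "bisection W" "g \<in> W" "r ` W \<subseteq> {r g}"
      using bisection_into[OF g _ point[OF r_in_units[OF g]]] by blast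
    then have "W = {g}" using bisection_inj_r[OF W(1)] by (auto simp: inj_on_def)
    then show ?thesis using W(1) bisection_compact_open compact_open_openin by auto
  qed
  have connect: "\<exists>g\<in>topspace X. s g = x \<and> r g = y" if "x \<in> G0" "y \<in> G0" for x y
    using minimal_arrow[OF min that(1) point[OF that(2)]] that(2) by blast
  \<comment> \<open>Any two units are joined by an arrow that is itself a bisection, so they have
    the same mass. This mass is positive, hence equal measure means equal cardinality.\<close>
  have "card U = card V"
  proof -
    obtain \<mu> where \<mu>: "\<mu> \<in> invariant_measures X G0 r s" using M by blast
    interpret prob_space \<mu> using \<mu> by (rule invariant_measure_prob_space)
    have const: "measure \<mu> {x} = measure \<mu> {z}" if x: "x \<in> G0" for x
    proof -
      obtain g where g: "g \<in> topspace X" "s g = x" "r g = z" using connect[OF x isolated(1)] by blast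
      have "bisection {g}" using arrow[OF g(1)] g(1) by (simp add: bisection_def compact_open_def)
      then show ?thesis using measure_bisection[OF \<mu>, of "{g}"] g by simp
    qed
    have count: "measure \<mu> A = real (card A) * measure \<mu> {z}" if A: "A \<subseteq> G0" "finite A" for A
    proof -
      have "measure \<mu> A = (\<Sum>x\<in>A. measure \<mu> {x})"
        using A point open_in_sets[OF \<mu>] by (intro finite_measure_eq_sum_singleton) auto
      also have "\<dots> = (\<Sum>x\<in>A. measure \<mu> {z})" using const A(1) by (intro sum.cong) auto
      finally show ?thesis by simp
    qed
    have "compact_open {z}" using isolated units_subset by (auto simp: compact_open_def)
    then have "measure \<mu> {z} > 0" using invariant_measure_pos[OF min _ _ _ \<mu>] isolated(1) by blast
    then show ?thesis using count[OF U fin(1)] count[OF V fin(2)] eq[OF \<mu>] by simp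
  qed
  then have "card (U - {s g0}) = card (V - {r g0})" using g0 fin by simp
  then obtain h where h: "bij_betw h (U - {s g0}) (V - {r g0})"
    using fin finite_same_card_bij[of "U - {s g0}" "V - {r g0}"] by auto
  \<comment> \<open>Any bijection of the remaining points lifts to a set of arrows, since all units
    lie in one orbit and arrows are isolated too.\<close>
  have "\<exists>a. \<forall>x\<in>U - {s g0}. a x \<in> topspace X \<and> s (a x) = x \<and> r (a x) = h x"
    using connect U V bij_betwE[OF h] by (intro bchoice) blast
  then obtain a where a: "\<And>x. x \<in> U - {s g0} \<Longrightarrow> a x \<in> topspace X \<and> s (a x) = x \<and> r (a x) = h x"
    by blast
  define T where "T = a ` (U - {s g0})"
  have "openin X (\<Union>t\<in>T. {t})" using arrow a by (intro openin_Union) (auto simp: T_def)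
  then have oT: "openin X T" by simp
  have injs: "inj_on s T" using a by (auto simp: T_def inj_on_def)
  have injr: "inj_on r T" using a bij_betw_imp_inj_on[OF h] by (auto simp: T_def inj_on_def)
  have sT: "s ` T = U - {s g0}" using a by (force simp: T_def image_image)
  have "r ` T = h ` (U - {s g0})" unfolding T_def image_image using a by (intro image_cong) auto
  then have rT: "r ` T = V - {r g0}" using bij_betw_imp_surj_on[OF h] by simp
  show ?thesis
  proof (rule swapping_involution[OF _ U _ V disj _ oT injr injs sT rT g0])
    show "openin X U" "openin X V" "openin X (G0 - (U \<union> V))" using disc U V by auto
  next
    \<comment> \<open>In the discrete topology \<open>{s g0}\<close> and \<open>{r g0}\<close> are
      neighbourhoods that meet no end of an arrow of \<open>T\<close> on their side, so both limit
      conditions hold vacuously.\<close>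
    have "\<forall>t\<in>T. s t \<noteq> s g0" "\<forall>t\<in>T. r t \<noteq> r g0" using sT rT by auto
    then show "\<exists>N. openin X N \<and> s g0 \<in> N \<and> N \<subseteq> U \<and> (\<forall>t\<in>T. s t \<in> N \<longrightarrow> r t \<in> M)"
      "\<exists>N. openin X N \<and> r g0 \<in> N \<and> N \<subseteq> V \<and> (\<forall>t\<in>T. r t \<in> N \<longrightarrow> s t \<in> M)" for M
      using point U V g0 by (auto intro: exI[of _ "{s g0}"] exI[of _ "{r g0}"])
  qed
qed

text \<open>The common part of \<open>U\<close> and \<open>V\<close> can be fixed pointwise, so it
  suffices to swap the differences. These are disjoint and have equal measure, because the measure
  of the intersection cancels.\<close>

lemma equal_measures_imp_swap:
  assumes af: "almost_finite X G0 r s mul iv" and min: "minimal_groupoid X G0 r s"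
    and U: "compact_open U" "U \<subseteq> G0" and V: "compact_open V" "V \<subseteq> G0"
    and eq: "\<And>\<mu>. \<mu> \<in> invariant_measures X G0 r s \<Longrightarrow> measure \<mu> U = measure \<mu> V"
  shows "\<exists>\<gamma>\<in>full_group X G0 r s. \<gamma> ` U = V \<and>
           (\<forall>x\<in>G0. \<gamma> (\<gamma> x) = x) \<and> (\<forall>x\<in>G0 - (U \<union> V). \<gamma> x = x)"
proof (cases "U = V")
  case True
  have "id \<in> full_group X G0 r s"
    using units_subset by (force simp: full_group_def)
  then show ?thesis using True by (intro bexI[of _ id]) auto
next
  case False
  define U' where "U' = U - V"
  define V' where "V' = V - U"
  have U': "compact_open U'" "U' \<subseteq> G0" and V': "compact_open V'" "V' \<subseteq> G0"
    using U V compact_open_Diff by (auto simp: U'_def V'_def)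
  have disj: "U' \<inter> V' = {}" by (auto simp: U'_def V'_def)
  have eq': "measure \<mu> U' = measure \<mu> V'" if \<mu>: "\<mu> \<in> invariant_measures X G0 r s" for \<mu>
  proof -
    interpret prob_space \<mu> using \<mu> by (rule invariant_measure_prob_space)
    have "U \<in> sets \<mu>" "V \<in> sets \<mu>" using clopen_in_sets[OF \<mu>] U V by auto
    then show ?thesis
      using finite_measure_Diff'[of U V] finite_measure_Diff'[of V U] eq[OF \<mu>]
      by (simp add: U'_def V'_def Int_commute)
  qed
  have "G0 \<noteq> {}" using False U V by blast
  then have M: "invariant_measures X G0 r s \<noteq> {}" using invariant_measures_nonempty[OF af] by blast
  then obtain \<mu> where \<mu>: "\<mu> \<in> invariant_measures X G0 r s" by blast
  have "U' \<noteq> {} \<or> V' \<noteq> {}" using False by (auto simp: U'_def V'_def)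
  \<comment> \<open>If just one difference were empty, the other would have positive measure and the
    first measure 0.\<close>
  then have ne: "U' \<noteq> {}" "V' \<noteq> {}"
    using invariant_measure_pos[OF min U' _ \<mu>] invariant_measure_pos[OF min V' _ \<mu>] eq'[OF \<mu>]
    by (metis less_irrefl measure_empty)+
  then obtain x0 where x0: "x0 \<in> U'" by blast
  then obtain g0 where g0: "g0 \<in> topspace X" "s g0 \<in> U'" "r g0 \<in> V'"
    using minimal_arrow[OF min _ compact_open_openin[OF V'(1)] V'(2) ne(2), of x0] U'(2) by blast
  have "\<exists>\<gamma>\<in>full_group X G0 r s. \<gamma> ` U' = V' \<and> \<gamma> ` V' = U' \<and>
           (\<forall>x\<in>G0. \<gamma> (\<gamma> x) = x) \<and> (\<forall>x\<in>G0 - (U' \<union> V'). \<gamma> x = x)"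
  proof (cases "\<exists>z\<in>G0. openin X {z}")
    case True
    then show ?thesis using swap_isolated[OF min M _ _ U'(2) V'(2) disj g0 eq'] by blast
  next
    case False
    then show ?thesis using swap_perfect[OF af min _ U' V' disj g0 eq'] by blast
  qed
  then obtain \<gamma> where \<gamma>: "\<gamma> \<in> full_group X G0 r s" "\<gamma> ` U' = V'"
    "\<forall>x\<in>G0. \<gamma> (\<gamma> x) = x" "\<forall>x\<in>G0 - (U' \<union> V'). \<gamma> x = x" by blast
  have "\<gamma> ` (U \<inter> V) = U \<inter> V"
    using \<gamma>(4) U(2) by (force simp: U'_def V'_def)
  moreover have "U = U' \<union> (U \<inter> V)" "V = V' \<union> (U \<inter> V)" by (auto simp: U'_def V'_def)
  ultimately have "\<gamma> ` U = V" using \<gamma>(2) by (metis image_Un)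
  moreover have "\<forall>x\<in>G0 - (U \<union> V). \<gamma> x = x" using \<gamma>(4) by (auto simp: U'_def V'_def)
  ultimately show ?thesis using \<gamma> by blast
qed

end

theorem theorem6p11:
  fixes X :: "'g topology" and G0 :: "'g set" and r s iv :: "'g \<Rightarrow> 'g"
    and mul :: "'g \<Rightarrow> 'g \<Rightarrow> 'g" and U V :: "'g set"
  assumes "etale_groupoid X G0 r s mul iv"
    and "second_countable X"
    and "compact_space (subtopology X G0)"
    and "totally_disconnected_space (subtopology X G0)"
    and "almost_finite X G0 r s mul iv"
    and "minimal_groupoid X G0 r s"
    and "closedin (subtopology X G0) U" and "openin (subtopology X G0) U"
    and "closedin (subtopology X G0) V" and "openin (subtopology X G0) V"
  shows "((\<exists>\<gamma>\<in>full_group X G0 r s. \<gamma> ` U = V) \<longleftrightarrow>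
            (\<forall>\<mu>\<in>invariant_measures X G0 r s. measure \<mu> U = measure \<mu> V))
       \<and> ((\<exists>\<gamma>\<in>full_group X G0 r s. \<gamma> ` U = V) \<longrightarrow>
            (\<exists>\<gamma>\<in>full_group X G0 r s. \<gamma> ` U = V \<and>
                (\<forall>x\<in>G0. \<gamma> (\<gamma> x) = x) \<and> (\<forall>x\<in>G0 - (U \<union> V). \<gamma> x = x)))"
proof -
  interpret ample_groupoid X G0 r s mul iv
    using assms(1-4) by unfold_locales
  have U: "compact_open U" "U \<subseteq> G0" and V: "compact_open V" "V \<subseteq> G0"
    using clopen_iff assms(7-10) by auto
  have "measure \<mu> U = measure \<mu> V"
    if "\<gamma> \<in> full_group X G0 r s" "\<gamma> ` U = V" "\<mu> \<in> invariant_measures X G0 r s" for \<gamma> \<mu>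
    using full_group_measure_preserving[OF that(3,1) clopen_in_sets[OF that(3) U]] that(2) by simp
  \<comment> \<open>Equality of measures already yields the involution. With the preservation of
    measures this closes the equivalence and gives the addendum.\<close>
  moreover have "\<exists>\<gamma>\<in>full_group X G0 r s. \<gamma> ` U = V \<and>
      (\<forall>x\<in>G0. \<gamma> (\<gamma> x) = x) \<and> (\<forall>x\<in>G0 - (U \<union> V). \<gamma> x = x)"
    if "\<forall>\<mu>\<in>invariant_measures X G0 r s. measure \<mu> U = measure \<mu> V"
    using equal_measures_imp_swap[OF assms(5,6) U V] that by blast
  ultimately show ?thesis by blast
qed

end
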